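(* As $n\to\infty$: (a) $H_n(C_6)\le n^{\frac{2}{3}n+o(n)}$; (b) $H_n(C_8)\le n^{\frac{4}{5}n+o(n)}$; (c) $H_n(C_{10})\le n^{\frac{4}{5}n+o(n)}$.
   Context: For a graph $G$, $H_n(G)$ denotes the maximum number of Hamilton paths in the complete graph $K_n$ such that the union of any two of them contains $G$ as a subgraph. $C_m$ denotes the cycle of length $m$. *)

theory Defs
  imports Complex_Main "HOL-Library.Landau_Symbols"
begin

text \<open>Vertices of K_n are 0..n-1. A subgraph is given by its edge set; edges are 2-element sets.
  A Hamilton path of K_n is the edge set of a path visiting every vertex once.\<close>

definition path_edges :: "nat list \<Rightarrow> nat set set" where
  "path_edges xs = {{xs ! i, xs ! (Suc i)} | i. Suc i < length xs}"

definition ham_paths :: "nat \<Rightarrow> nat set set set" where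
  "ham_paths n = {path_edges xs | xs. distinct xs \<and> set xs = {0..<n}}"

definition contains_cycle :: "nat set set \<Rightarrow> nat \<Rightarrow> bool" where
  "contains_cycle E m \<longleftrightarrow> (\<exists>vs. length vs = m \<and> distinct vs \<and>
      (\<forall>i<m. {vs ! i, vs ! ((Suc i) mod m)} \<in> E))"

definition H_cycle :: "nat \<Rightarrow> nat \<Rightarrow> nat" where
  "H_cycle n m = Max {card F | F. F \<subseteq> ham_paths n \<and>
      (\<forall>P\<in>F. \<forall>Q\<in>F. P \<noteq> Q \<longrightarrow> contains_cycle (P \<union> Q) m)}"

end

theory Submission
  imports Defs "HOL-Number_Theory.Number_Theory" "HOL-Combinatorics.Permutations"
    "HOL-Computational_Algebra.Polynomial" "HOL-Real_Asymp.Real_Asymp"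
begin

text \<open>Let \<open>G\<close> be a graph on \<open>n\<close> vertices without a cycle of length \<open>2 h\<close>, and let \<open>J\<close> be the set of
  Hamilton paths with only \<open>o(n)\<close> edges outside \<open>G\<close>. A creating family inside \<open>J\<close> has at most
  \<open>n\<^sup>o\<^sup>(\<^sup>n\<^sup>)\<close> members: if two paths agree near their edges outside \<open>G\<close>, a cycle of length \<open>2 h\<close> in their union
  would lie in \<open>G\<close> or in one of the paths. Averaging over the symmetric group, any creating family has at most
  \<open>n! n\<^sup>o\<^sup>(\<^sup>n\<^sup>) / card J\<close> members.

  For \<open>G\<close> we take copies of an algebraically defined bipartite graph of degree \<open>p\<close> on \<open>2 p\<^sup>k\<close> vertices, with \<open>k = 3\<close>
  for \<open>C\<^sub>6\<close> and \<open>k = 5\<close> for \<open>C\<^sub>8\<close> and \<open>C\<^sub>1\<^sub>0\<close>. Its vertices are split into layers with \<open>t\<close>-regular bipartite graphs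
  between consecutive layers, so that a matching of each layer into the next one is a linear forest.
  Counting augmenting walks shows that there are \<open>t\<close> to the power \<open>n - o(n)\<close> almost perfect such matchings, whence
  \<open>card J \<ge> n\<close> to the power \<open>n / k - o(n)\<close>.\<close>

section \<open>Almost perfect matchings in regular bipartite graphs\<close>

text \<open>A path close to G needs about n edges of G, but a matching of points with lines supplies
  only n/2. Hence the chain of layers: its forward edges form a bipartite graph between tails and
  heads, where almost every vertex occurs on both sides. The price is a drop of the degree from p to
  \<open>p div s\<close>, a constant factor for fixed \<epsilon>. Constants to the power n disappear
  in n^o(n). So a crude count of matchings replaces a sharp permanent bound, a path may be counted
  2^n times, and p has to match n^(1/k) only up to a factor n^o(1). The exponent 1 - 1/k is that of
  n! / t^n with t = n^(1/k - o(1)). Here k - 1 is the number d of monomials defining the graph. A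
  cycle of length 2h gives cyclic sequences a, b of length h with distinct neighbours, and h - 1
  monomials x y^j force every value of b to be repeated. For h = 3 and h = 5 this is impossible. For
  h = 4 the pattern u v u v survives and a further monomial has to exclude it, which is why C_8
  costs as much as C_10.\<close>

definition matching :: "('a \<times> 'b) set \<Rightarrow> ('a \<times> 'b) set \<Rightarrow> bool" where
  "matching D M \<longleftrightarrow> M \<subseteq> D \<and> inj_on fst M \<and> inj_on snd M"

lemma mem_fst_image: "(x, y) \<in> M \<Longrightarrow> x \<in> fst ` M" by (metis fst_conv image_eqI)

lemma matching_fst_eq: "matching D M \<Longrightarrow> (x, y) \<in> M \<Longrightarrow> (x, y') \<in> M \<Longrightarrow> y = y'"
  unfolding matching_def inj_on_def by fastforce

lemma matching_snd_eq: "matching D M \<Longrightarrow> (x, y) \<in> M \<Longrightarrow> (x', y) \<in> M \<Longrightarrow> x = x'"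
  unfolding matching_def inj_on_def by fastforce

text \<open>Alternating walks with respect to a matching \<open>M\<close>, listed from the last edge outside \<open>M\<close>
  back to the first one, whose left end is unmatched; the edges of \<open>M\<close> in between are implicit.\<close>

fun alt_walk :: "('a \<times> 'b) set \<Rightarrow> ('a \<times> 'b) set \<Rightarrow> ('a \<times> 'b) list \<Rightarrow> bool" where
  "alt_walk D M [] \<longleftrightarrow> False"
| "alt_walk D M [e] \<longleftrightarrow> e \<in> D \<and> fst e \<notin> fst ` M"
| "alt_walk D M (e # e' # es) \<longleftrightarrow> alt_walk D M (e' # es) \<and> (fst e, snd e') \<in> M \<and> e \<in> D
     \<and> snd e \<notin> snd ` set (e' # es)"

fun links :: "('a \<times> 'b) list \<Rightarrow> ('a \<times> 'b) set" where
  "links (e # e' # es) = insert (fst e, snd e') (links (e' # es))"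
| "links _ = {}"

text \<open>Distinct right ends are part of the definition. Distinct left ends follow: equal left
  ends would have the same partner in \<open>M\<close>, yet these partners are right ends of
  different edges of the walk. Only the first edge starts at an unmatched vertex, so there is one
  link fewer than there are edges.\<close>

lemma alt_walk_props:
  assumes "matching D M" "alt_walk D M es"
  shows "links es \<subseteq> M" "set es \<subseteq> D" "set es \<inter> M = {}" "inj_on snd (set es)" "inj_on fst (set es)"
    "fst ` links es = fst ` set es \<inter> fst ` M" "snd ` links es = snd ` set (tl es)"
    "card (set es) = length es" "card (links es) = length es - 1"
proof -
  have "links es \<subseteq> M \<and> set es \<subseteq> D \<and> set es \<inter> M = {} \<and> inj_on snd (set es) \<and> inj_on fst (set es) \<and>
    fst ` links es = fst ` set es \<inter> fst ` M \<and> snd ` links es = snd ` set (tl es) \<and>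
    card (set es) = length es \<and> card (links es) = length es - 1"
    using assms(2)
  proof (induction es rule: links.induct)
    case (1 e e' es)
    then have IH: "links (e' # es) \<subseteq> M" "set (e' # es) \<subseteq> D" "set (e' # es) \<inter> M = {}"
      "inj_on snd (set (e' # es))" "inj_on fst (set (e' # es))"
      "fst ` links (e' # es) = fst ` set (e' # es) \<inter> fst ` M" "snd ` links (e' # es) = snd ` set es"
      "card (set (e' # es)) = length (e' # es)" "card (links (e' # es)) = length es"
      by auto
    have e: "(fst e, snd e') \<in> M" "e \<in> D" "snd e \<notin> snd ` set (e' # es)"
      using 1(2) by auto
    have eM: "e \<notin> M"
    proof
      assume "e \<in> M"
      then have "snd e = snd e'"
        using matching_fst_eq[OF assms(1), of "fst e" "snd e" "snd e'"] e by simp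
      with e(3) show False by auto
    qed
    have new: "snd e' \<notin> snd ` set es"
    proof (cases es)
      case (Cons a list)
      then show ?thesis using 1(2) by auto
    qed simp
    have f: "fst e \<notin> fst ` set (e' # es)"
    proof
      assume a: "fst e \<in> fst ` set (e' # es)"
      have "fst e \<in> fst ` M" using e(1) by (metis fst_conv image_eqI)
      with a IH(6) have "fst e \<in> fst ` links (e' # es)" by blast
      then obtain z where z: "z \<in> links (e' # es)" "fst z = fst e" by auto
      with IH(1) have "snd z = snd e'"
        using matching_fst_eq[OF assms(1), of "fst e" "snd z" "snd e'"] e(1) by (metis prod.collapse subsetD)
      with z(1) IH(7) new show False by (metis image_eqI)
    qed
    have "(fst e, snd e') \<notin> links (e' # es)"
      using new IH(7) by (metis image_eqI snd_conv)
    moreover have "finite (links xs)" for xs :: "('a \<times> 'b) list" by (induction xs rule: links.induct) auto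
    ultimately have cl: "card (links (e # e' # es)) = Suc (length es)"
      using IH(9) by simp
    have ne: "e \<notin> set (e' # es)" using e(3) by auto
    have i1: "inj_on snd (set (e # e' # es))"
      using IH(4) e(3) ne by (simp add: inj_on_insert)
    have i2: "inj_on fst (set (e # e' # es))"
      using IH(5) f ne by (simp add: inj_on_insert)
    have fl: "fst ` links (e # e' # es) = fst ` set (e # e' # es) \<inter> fst ` M"
    proof -
      have "fst e \<in> fst ` M" using e(1) by (metis fst_conv image_eqI)
      then show ?thesis using IH(6) by auto
    qed
    have cs: "card (set (e # e' # es)) = length (e # e' # es)"
      using IH(8) ne by (metis card_insert_disjoint length_Cons list.set(2) List.finite_set)
    have sl: "snd ` links (e # e' # es) = snd ` set (tl (e # e' # es))"
      using IH(7) by simp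
    show ?case
      using i1 i2 fl cs sl cl IH(1,2,3) e(1,2) eM by simp
  next
    case ("2_2" e)
    moreover have "e \<notin> M" using "2_2" by auto
    ultimately show ?case by auto
  qed simp
  then show "links es \<subseteq> M" "set es \<subseteq> D" "set es \<inter> M = {}" "inj_on snd (set es)" "inj_on fst (set es)"
    "fst ` links es = fst ` set es \<inter> fst ` M" "snd ` links es = snd ` set (tl es)"
    "card (set es) = length es" "card (links es) = length es - 1" by auto
qed

definition augment :: "('a \<times> 'b) set \<Rightarrow> ('a \<times> 'b) list \<Rightarrow> ('a \<times> 'b) set" where
  "augment M es = (M - links es) \<union> set es"

text \<open>At left ends the links removed are exactly the edges of \<open>M\<close> in conflict
  with the walk. At right ends the same holds except at the final vertex \<open>snd (hd es)\<close>,
  which is unmatched by hypothesis.\<close>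

lemma augment_matching:
  assumes M: "matching D M" and w: "alt_walk D M es" and last: "snd (hd es) \<notin> snd ` M"
  shows "matching D (augment M es)"
proof -
  note p = alt_walk_props[OF M w]
  have ne: "es \<noteq> []" using w by auto
  have "inj_on fst (augment M es)"
    unfolding augment_def
  proof (subst inj_on_Un, intro conjI)
    show "inj_on fst (M - links es)" using M unfolding matching_def by (meson Diff_subset inj_on_subset)
    show "fst ` (M - links es - set es) \<inter> fst ` (set es - (M - links es)) = {}"
    proof (rule ccontr)
      assume "\<not> ?thesis"
      then obtain a b where ab: "a \<in> M" "a \<notin> links es" "b \<in> set es" "fst a = fst b" by blast
      then have "fst a \<in> fst ` links es" using p(6) by (metis IntI image_eqI)
      then obtain c where c: "c \<in> links es" "fst c = fst a" by auto
      then have "c = a" using ab(1) p(1) M unfolding matching_def inj_on_def by blast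
      with c ab show False by simp
    qed
  qed (use p in auto)
  moreover have "inj_on snd (augment M es)"
    unfolding augment_def
  proof (subst inj_on_Un, intro conjI)
    show "inj_on snd (M - links es)" using M unfolding matching_def by (meson Diff_subset inj_on_subset)
    show "snd ` (M - links es - set es) \<inter> snd ` (set es - (M - links es)) = {}"
    proof (rule ccontr)
      assume "\<not> ?thesis"
      then obtain a b where ab: "a \<in> M" "a \<notin> links es" "b \<in> set es" "snd a = snd b" by blast
      have "b \<noteq> hd es" using ab last by (metis image_eqI)
      then have "b \<in> set (tl es)" using ab(3) ne by (metis list.collapse set_ConsD)
      then have "snd a \<in> snd ` links es" using p(7) ab(4) by auto
      then obtain c where c: "c \<in> links es" "snd c = snd a" by auto
      then have "c = a" using ab(1) p(1) M unfolding matching_def inj_on_def by blast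
      with c ab show False by simp
    qed
  qed (use p in auto)
  moreover have "augment M es \<subseteq> D" using p M unfolding augment_def matching_def by auto
  ultimately show ?thesis unfolding matching_def by blast
qed

lemma augment_card:
  assumes "matching D M" "alt_walk D M es" "finite M"
  shows "card (augment M es) = Suc (card M)"
proof -
  note p = alt_walk_props[OF assms(1,2)]
  have "length es > 0" using assms(2) by auto
  have "card (augment M es) = card (M - links es) + card (set es)"
    unfolding augment_def by (rule card_Un_disjoint) (use p(3) assms(3) in auto)
  also have "card (M - links es) = card M - card (links es)"
    using p(1) assms(3) finite_subset by (intro card_Diff_subset) auto
  also have "\<dots> = card M - (length es - 1)" using p(9) by simp
  finally have "card (augment M es) = card M - (length es - 1) + length es" using p(8) by simp
  moreover have "length es - 1 \<le> card M" using p(1,9) card_mono[OF assms(3)] by metis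
  ultimately show ?thesis using \<open>length es > 0\<close> by linarith
qed

text \<open>Makes the map from \<open>(M, es)\<close> to \<open>(augment M es, es)\<close> injective
  in the double counting of \<open>sum_aug_walks\<close>.\<close>

lemma augment_inverse:
  assumes "matching D M" "alt_walk D M es"
  shows "M = (augment M es - set es) \<union> links es"
  using alt_walk_props[OF assms] unfolding augment_def by blast

text \<open>The trace of an alternating walk in the augmented matching, which replaces \<open>M\<close> here.\<close>

fun rev_walk :: "('a \<times> 'b) set \<Rightarrow> ('a \<times> 'b) set \<Rightarrow> ('a \<times> 'b) list \<Rightarrow> bool" where
  "rev_walk D M [] \<longleftrightarrow> False"
| "rev_walk D M [e] \<longleftrightarrow> e \<in> M"
| "rev_walk D M (e # e' # es) \<longleftrightarrow> e \<in> M \<and> (fst e, snd e') \<in> D \<and> rev_walk D M (e' # es)"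

lemma alt_walk_imp_rev_walk:
  assumes "alt_walk D M es" "M \<subseteq> D" "set es \<subseteq> M'"
  shows "rev_walk D M' es"
  using assms by (induction es rule: links.induct) auto

section \<open>Counting matchings of a biregular graph by augmenting walks\<close>

locale biregular =
  fixes D :: "('a \<times> 'b) set" and X :: "'a set" and Y :: "'b set" and t :: nat
  assumes fin: "finite X" "finite Y" and sub: "D \<subseteq> X \<times> Y"
    and degX: "\<And>x. x \<in> X \<Longrightarrow> card {y. (x, y) \<in> D} = t"
    and degY: "\<And>y. y \<in> Y \<Longrightarrow> card {x. (x, y) \<in> D} = t"
    and t_pos: "t > 0"
begin

lemma fin_D: "finite D"
  using fin sub finite_subset by (metis finite_SigmaI)

lemma fin_nbr: "finite {y. (x, y) \<in> D}" "finite {x. (x, y) \<in> D}"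
  using fin sub by (auto intro: finite_subset[of _ Y] finite_subset[of _ X])

lemma card_D: "card D = t * card X"
proof -
  have "D = Sigma X (\<lambda>x. {y. (x, y) \<in> D})" using sub by auto
  then have "card D = (\<Sum>x\<in>X. card {y. (x, y) \<in> D})"
    using card_SigmaI[OF fin(1), of "\<lambda>x. {y. (x, y) \<in> D}"] fin_nbr by simp
  also have "\<dots> = t * card X" using degX by simp
  finally show ?thesis .
qed

lemma finite_bounded_lists: "finite {es. set es \<subseteq> D \<and> length es = n}"
  by (rule finite_lists_length_eq[OF fin_D])

definition walks :: "('a \<times> 'b) set \<Rightarrow> nat \<Rightarrow> ('a \<times> 'b) list set" where
  "walks M i = {es. alt_walk D M es \<and> length es = Suc i}"

lemma alt_walk_subset: "alt_walk D M es \<Longrightarrow> set es \<subseteq> D"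
  by (induction es rule: links.induct) auto

lemma finite_walks: "finite (walks M i)"
  by (rule finite_subset[OF _ finite_bounded_lists[of "Suc i"]]) (use alt_walk_subset in \<open>auto simp: walks_def\<close>)

text \<open>The walk starts in an edge of \<open>M'\<close>, of which there are at most
  \<open>card X\<close>. Each further edge is determined by its left end, one of the
  \<open>t\<close> neighbours of the previous right end.\<close>

lemma card_rev_walks:
  assumes "matching D M'"
  shows "finite {es. rev_walk D M' es \<and> length es = Suc i}"
    and "card {es. rev_walk D M' es \<and> length es = Suc i} \<le> card X * t ^ i"
proof -
  have MD: "M' \<subseteq> D" using assms unfolding matching_def by auto
  have finM: "finite M'" using MD fin_D finite_subset by auto
  have "finite {es. rev_walk D M' es \<and> length es = Suc i} \<and>
     card {es. rev_walk D M' es \<and> length es = Suc i} \<le> card X * t ^ i"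
  proof (induction i)
    case 0
    have eq: "{es. rev_walk D M' es \<and> length es = Suc 0} = (\<lambda>e. [e]) ` M'"
      by (auto simp: length_Suc_conv image_iff)
    have "card M' = card (fst ` M')" using assms unfolding matching_def by (simp add: card_image)
    also have "\<dots> \<le> card X" using MD sub fin by (intro card_mono) auto
    finally show ?case unfolding eq using finM by (auto simp: card_image inj_on_def)
  next
    case (Suc i)
    let ?R = "\<lambda>i. {es. rev_walk D M' es \<and> length es = Suc i}"
    let ?P = "Sigma (?R i) (\<lambda>es. {x. (x, snd (hd es)) \<in> D})"
    \<comment> \<open>If \<open>x\<close> is unmatched, \<open>THE\<close> yields an arbitrary edge.
      This is harmless, since \<open>?f\<close> only has to cover the longer walks.\<close>
    let ?f = "\<lambda>(es, x). ((THE e. e \<in> M' \<and> fst e = x) # es)"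
    have "?R (Suc i) \<subseteq> ?f ` ?P"
    proof
      fix es assume "es \<in> ?R (Suc i)"
      then obtain e e' es' where es: "es = e # e' # es'" and h: "e \<in> M'" "(fst e, snd e') \<in> D"
        "rev_walk D M' (e' # es')" "length (e' # es') = Suc i"
        by (auto simp: length_Suc_conv)
      have "(THE e0. e0 \<in> M' \<and> fst e0 = fst e) = e"
        using h(1) assms unfolding matching_def inj_on_def by (intro the_equality) auto
      then have "es = ?f (e' # es', fst e)" using es by simp
      moreover have "(e' # es', fst e) \<in> ?P" using h by auto
      ultimately show "es \<in> ?f ` ?P" by blast
    qed
    moreover have "finite ?P" using Suc fin_nbr by auto
    moreover have "card ?P \<le> card X * t ^ Suc i"
    proof -
      have "card ?P = (\<Sum>es\<in>?R i. card {x. (x, snd (hd es)) \<in> D})"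
        using Suc fin_nbr by (intro card_SigmaI) auto
      also have "\<dots> \<le> (\<Sum>es\<in>?R i. t)"
      proof (rule sum_mono)
        fix es assume "es \<in> ?R i"
        then obtain e es' where "es = e # es'" "e \<in> M'"
          by (cases es rule: links.cases) auto
        then have "snd (hd es) \<in> Y" using MD sub by auto
        then show "card {x. (x, snd (hd es)) \<in> D} \<le> t" using degY by simp
      qed
      also have "\<dots> = card (?R i) * t" by simp
      also have "\<dots> \<le> card X * t ^ i * t" using Suc by (intro mult_right_mono) auto
      finally show ?thesis by (simp add: mult_ac)
    qed
    ultimately show ?case using finite_subset[of "?R (Suc i)" "?f ` ?P"] surj_card_le[of ?P "?R (Suc i)" ?f] by auto
  qed
  then show "finite {es. rev_walk D M' es \<and> length es = Suc i}"
    and "card {es. rev_walk D M' es \<and> length es = Suc i} \<le> card X * t ^ i" by auto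
qed

definition matchings :: "nat \<Rightarrow> ('a \<times> 'b) set set" where
  "matchings k = {M. matching D M \<and> card M = k}"

lemma finite_matchings: "finite (matchings k)"
  by (rule finite_subset[of _ "Pow D"]) (use fin_D in \<open>auto simp: matchings_def matching_def\<close>)

lemma finite_matching: "M \<in> matchings k \<Longrightarrow> finite M"
  using fin_D finite_subset unfolding matchings_def matching_def by auto

definition aug_walks :: "('a \<times> 'b) set \<Rightarrow> nat \<Rightarrow> ('a \<times> 'b) list set" where
  "aug_walks M i = {es \<in> walks M i. snd (hd es) \<notin> snd ` M}"

lemma finite_aug_walks: "finite (aug_walks M i)"
  using finite_walks unfolding aug_walks_def by auto

lemma card_X_matched:
  assumes "M \<in> matchings k"
  shows "card (X - fst ` M) = card X - k" "k \<le> card X"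
proof -
  have M: "M \<subseteq> D" "inj_on fst M" "card M = k" using assms unfolding matchings_def matching_def by auto
  have s: "fst ` M \<subseteq> X" using M sub by auto
  have c: "card (fst ` M) = k" using M by (simp add: card_image)
  show "card (X - fst ` M) = card X - k"
    using s c fin finite_subset by (subst card_Diff_subset) auto
  show "k \<le> card X" using s c card_mono fin(1) by metis
qed

text \<open>Kraft's inequality: an alternating walk ending in the edge \<open>e\<close>, read backwards, is a run
  of a random walk that stops at the first unmatched vertex.\<close>

lemma sum_walks_to_edge:
  assumes "matching D M" "e \<in> D"
  shows "(\<Sum>i\<le>n. real (card {es \<in> walks M i. hd es = e}) / real t ^ i) \<le> 1"
  using assms(2)
proof (induction n arbitrary: e)
  let ?W = "\<lambda>i e. {es \<in> walks M i. hd es = e}"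
  have W0: "?W 0 e = (if fst e \<in> fst ` M then {} else {[e]})" if "e \<in> D" for e
    using that by (auto simp: walks_def length_Suc_conv dest: mem_fst_image)
  {
    case 0
    then show ?case by (simp add: W0)
  next
    case (Suc n)
    show ?case
    proof (cases "fst e \<in> fst ` M")
      case False
      have "?W (Suc i) e = {}" for i
      proof (rule ccontr)
        assume "?W (Suc i) e \<noteq> {}"
        then obtain e' es where "alt_walk D M (e # e' # es)" by (auto simp: walks_def length_Suc_conv)
        then have "(fst e, snd e') \<in> M" by simp
        with False show False by (metis fst_conv image_eqI)
      qed
      then show ?thesis using W0[OF Suc.prems] False
        by (simp only: sum.atMost_Suc_shift) simp
    next
      case True
      then obtain y where y: "(fst e, y) \<in> M" by auto
      let ?N = "{x. (x, y) \<in> D}"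
      have yY: "y \<in> Y" using y assms(1) sub unfolding matching_def by auto
      have le: "card (?W (Suc i) e) \<le> (\<Sum>x\<in>?N. card (?W i (x, y)))" for i
      proof -
        have "?W (Suc i) e \<subseteq> (#) e ` (\<Union>x\<in>?N. ?W i (x, y))"
        proof
          fix es assume "es \<in> ?W (Suc i) e"
          then obtain e' es' where h: "es = e # e' # es'" "length (e' # es') = Suc i" "alt_walk D M (e # e' # es')"
            by (auto simp: walks_def length_Suc_conv)
          then have "snd e' = y" using matching_fst_eq[OF assms(1) _ y] by simp
          moreover have "e' \<in> D" using h alt_walk_subset[of M "e # e' # es'"] by auto
          ultimately have "e' # es' \<in> ?W i (fst e', y)" "fst e' \<in> ?N"
            using h by (auto simp: walks_def)
          then show "es \<in> (#) e ` (\<Union>x\<in>?N. ?W i (x, y))" using h(1) by blast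
        qed
        then have "card (?W (Suc i) e) \<le> card (\<Union>x\<in>?N. ?W i (x, y))"
          by (rule surj_card_le[rotated]) (use fin_nbr finite_walks in auto)
        also have "\<dots> \<le> (\<Sum>x\<in>?N. card (?W i (x, y)))" by (rule card_UN_le) (use fin_nbr in auto)
        finally show ?thesis .
      qed
      have "(\<Sum>i\<le>Suc n. real (card (?W i e)) / real t ^ i) = (\<Sum>i\<le>n. real (card (?W (Suc i) e)) / real t ^ Suc i)"
        using W0[OF Suc.prems] True by (simp only: sum.atMost_Suc_shift) simp
      also have "\<dots> \<le> (\<Sum>i\<le>n. real (\<Sum>x\<in>?N. card (?W i (x, y))) / real t ^ Suc i)"
        by (intro sum_mono divide_right_mono) (use le in \<open>auto simp del: of_nat_sum\<close>)
      also have "\<dots> = (\<Sum>i\<le>n. \<Sum>x\<in>?N. real (card (?W i (x, y))) / real t ^ i / real t)"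
        by (simp add: sum_divide_distrib mult.commute)
      also have "\<dots> = (\<Sum>x\<in>?N. \<Sum>i\<le>n. real (card (?W i (x, y))) / real t ^ i / real t)"
        by (rule sum.swap)
      also have "\<dots> = (\<Sum>x\<in>?N. (\<Sum>i\<le>n. real (card (?W i (x, y))) / real t ^ i) / real t)"
        by (simp add: sum_divide_distrib)
      also have "\<dots> \<le> (\<Sum>x\<in>?N. 1 / real t)"
        by (intro sum_mono divide_right_mono Suc.IH) auto
      also have "\<dots> = 1" using degY[OF yY] t_pos by simp
      finally show ?thesis .
    qed
  }
qed

lemma sum_walks:
  assumes "matching D M"
  shows "(\<Sum>i\<le>n. real (card (walks M i)) / real t ^ i) \<le> real t * real (card X)"
proof -
  have c: "card (walks M i) = (\<Sum>e\<in>D. card {es \<in> walks M i. hd es = e})" for i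
  proof -
    have "hd ` walks M i \<subseteq> D"
    proof
      fix e assume "e \<in> hd ` walks M i"
      then obtain es where es: "e = hd es" "es \<in> walks M i" by auto
      then have "set es \<subseteq> D" "es \<noteq> []" using alt_walk_subset[of M es] by (auto simp: walks_def)
      then show "e \<in> D" using es(1) hd_in_set by blast
    qed
    then show ?thesis using sum.group[OF finite_walks fin_D, of hd M i "\<lambda>_. 1::nat"] by simp
  qed
  have "(\<Sum>i\<le>n. real (card (walks M i)) / real t ^ i)
      = (\<Sum>i\<le>n. \<Sum>e\<in>D. real (card {es \<in> walks M i. hd es = e}) / real t ^ i)"
    unfolding c by (simp add: sum_divide_distrib)
  also have "\<dots> = (\<Sum>e\<in>D. \<Sum>i\<le>n. real (card {es \<in> walks M i. hd es = e}) / real t ^ i)"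
    by (rule sum.swap)
  also have "\<dots> \<le> (\<Sum>e\<in>D. 1)" by (intro sum_mono sum_walks_to_edge assms)
  finally show ?thesis by (simp add: card_D)
qed

lemma card_walks_0:
  assumes "M \<in> matchings k"
  shows "card (walks M 0) = (card X - k) * t"
proof -
  have "walks M 0 = (\<lambda>e. [e]) ` (SIGMA x:X - fst ` M. {y. (x, y) \<in> D})"
    using sub by (auto simp: walks_def length_Suc_conv image_iff)
  then have "card (walks M 0) = card (SIGMA x:X - fst ` M. {y. (x, y) \<in> D})"
    by (simp add: card_image inj_on_def)
  also have "\<dots> = (\<Sum>x\<in>X - fst ` M. card {y. (x, y) \<in> D})"
    using fin fin_nbr by (intro card_SigmaI) auto
  also have "\<dots> = (card X - k) * t"
    using degX card_X_matched[OF assms] by simp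
  finally show ?thesis .
qed

text \<open>A walk that is not augmenting goes back along the matching edge at its right end and
  then has \<open>t\<close> edges to choose from, less those leading to one of its at most
  \<open>Suc i\<close> right ends. The matching edge itself is among the excluded ones.\<close>

lemma card_walks_Suc:
  assumes "matching D M"
  shows "card (walks M (Suc i)) \<ge> (card (walks M i) - card (aug_walks M i)) * (t - Suc i)"
proof -
  let ?partner = "\<lambda>es. (THE x. (x, snd (hd es)) \<in> M)"
  let ?N = "\<lambda>es. {y. (?partner es, y) \<in> D} - snd ` set es"
  let ?P = "Sigma (walks M i - aug_walks M i) ?N"
  let ?f = "\<lambda>(es, y). (?partner es, y) # es"
  have partner: "(?partner es, snd (hd es)) \<in> M" if "es \<in> walks M i - aug_walks M i" for es
  proof -
    have "snd (hd es) \<in> snd ` M" using that by (auto simp: aug_walks_def)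
    then obtain z where "z \<in> M" "snd z = snd (hd es)" by auto
    then have z: "(fst z, snd (hd es)) \<in> M" by (metis prod.collapse)
    then show ?thesis by (rule theI) (rule matching_snd_eq[OF assms _ z])
  qed
  have "card ?P \<le> card (walks M (Suc i))"
  proof (rule card_inj_on_le[of ?f])
    show "inj_on ?f ?P" by (auto simp: inj_on_def)
    show "?f ` ?P \<subseteq> walks M (Suc i)"
    proof clarify
      fix es y assume es: "es \<in> walks M i" "es \<notin> aug_walks M i"
        and y: "(?partner es, y) \<in> D" "y \<notin> snd ` set es"
      moreover obtain e es' where "es = e # es'" using es by (cases es) (auto simp: walks_def)
      ultimately show "(?partner es, y) # es \<in> walks M (Suc i)"
        using partner[of es] by (auto simp: walks_def)
    qed
  qed (rule finite_walks)
  moreover have "card ?P \<ge> (\<Sum>es\<in>walks M i - aug_walks M i. t - Suc i)"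
  proof -
    have "card ?P = (\<Sum>es\<in>walks M i - aug_walks M i. card (?N es))"
      using finite_walks fin_nbr by (intro card_SigmaI) auto
    moreover have "card (?N es) \<ge> t - Suc i" if "es \<in> walks M i - aug_walks M i" for es
    proof -
      have "?partner es \<in> X" using partner[OF that] assms sub unfolding matching_def by auto
      then have "card {y. (?partner es, y) \<in> D} = t" by (rule degX)
      moreover have "card (snd ` set es) \<le> Suc i"
        using that card_image_le[of "set es" snd] card_length[of es] by (auto simp: walks_def)
      ultimately show ?thesis
        using diff_card_le_card_Diff[of "snd ` set es" "{y. (?partner es, y) \<in> D}"] by simp
    qed
    ultimately show ?thesis by (metis (no_types, lifting) sum_mono)
  qed
  moreover have "(\<Sum>es\<in>walks M i - aug_walks M i. t - Suc i) = (card (walks M i) - card (aug_walks M i)) * (t - Suc i)"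
    using finite_aug_walks by (subst sum_constant, subst card_Diff_subset) (auto simp: aug_walks_def)
  ultimately show ?thesis by linarith
qed

text \<open>Augmenting sends a matching and its walk injectively to a matching with one edge more
  and the same list of edges, which is a reverse walk there.\<close>

lemma sum_aug_walks:
  "(\<Sum>M\<in>matchings k. card (aug_walks M i)) \<le> card (matchings (Suc k)) * (card X * t ^ i)"
proof -
  let ?P = "Sigma (matchings k) (\<lambda>M. aug_walks M i)"
  let ?Q = "Sigma (matchings (Suc k)) (\<lambda>M. {es. rev_walk D M es \<and> length es = Suc i})"
  let ?f = "\<lambda>(M, es). (augment M es, es)"
  have "card ?P \<le> card ?Q"
  proof (rule card_inj_on_le[of ?f])
    show "inj_on ?f ?P"
    proof (rule inj_onI)
      fix z z' assume "z \<in> ?P" "z' \<in> ?P" "?f z = ?f z'"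
      moreover obtain M es M' es' where "z = (M, es)" "z' = (M', es')" by (metis prod.exhaust)
      ultimately show "z = z'"
        using augment_inverse[of D M es] augment_inverse[of D M' es']
        unfolding matchings_def aug_walks_def walks_def by auto
    qed
    show "?f ` ?P \<subseteq> ?Q"
    proof
      fix w assume "w \<in> ?f ` ?P"
      then obtain M es where a: "M \<in> matchings k" "es \<in> aug_walks M i" "w = (augment M es, es)" by auto
      then have h: "matching D M" "card M = k" "alt_walk D M es" "snd (hd es) \<notin> snd ` M" "length es = Suc i"
        unfolding matchings_def aug_walks_def walks_def by auto
      have "M \<subseteq> D" using h unfolding matching_def by auto
      then have "rev_walk D (augment M es) es"
        using h by (intro alt_walk_imp_rev_walk[of D M]) (auto simp: augment_def)
      then show "w \<in> ?Q"
        using h a(3) augment_matching[of D M es] augment_card[of D M es] finite_matching[OF a(1)]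
        unfolding matchings_def by auto
    qed
    show "finite ?Q"
      using finite_matchings card_rev_walks(1) by (intro finite_SigmaI) (auto simp: matchings_def)
  qed
  also have "card ?Q = (\<Sum>M\<in>matchings (Suc k). card {es. rev_walk D M es \<and> length es = Suc i})"
    using finite_matchings card_rev_walks(1) by (intro card_SigmaI) (auto simp: matchings_def)
  also have "\<dots> \<le> (\<Sum>M\<in>matchings (Suc k). card X * t ^ i)"
    by (intro sum_mono card_rev_walks(2)) (auto simp: matchings_def)
  finally have "card ?P \<le> card (matchings (Suc k)) * (card X * t ^ i)" by simp
  moreover have "card ?P = (\<Sum>M\<in>matchings k. card (aug_walks M i))"
    using finite_matchings finite_aug_walks by (intro card_SigmaI) auto
  ultimately show ?thesis by simp
qed

text \<open>If almost no alternating walk of length below \<open>L\<close> could be completed to an augmenting one,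
  the number of walks of each such length would stay near its initial value times a power of \<open>t\<close>,
  contradicting Kraft's inequality.\<close>

lemma aug_walks_mass:
  assumes M: "M \<in> matchings k" and eps: "0 < \<epsilon>" "\<epsilon> \<le> 1" and k: "real k \<le> (1 - \<epsilon>) * real (card X)"
    and L: "real L \<ge> 4 / \<epsilon>" and t: "real t \<ge> 4 * (real L)\<^sup>2 / \<epsilon>"
  shows "(\<Sum>i<L. real (card (aug_walks M i)) / real t ^ Suc i) \<ge> \<epsilon> * real (card X) / 2"
proof -
  define N where "N = real (card X)"
  \<comment> \<open>The exponent \<open>Suc i\<close> normalises so that \<open>a 0\<close> is the
    number of unmatched left vertices and Kraft's inequality bounds the sum of all
    \<open>a i\<close> by \<open>N\<close>.\<close>
  define a where "a i = real (card (walks M i)) / real t ^ Suc i" for i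
  define w where "w i = real (card (aug_walks M i)) / real t ^ Suc i" for i
  have mM: "matching D M" using M by (simp add: matchings_def)
  have tp: "real t > 0" using t_pos by simp
  have L0: "L > 0" using L eps(1) by (metis divide_pos_pos gr0I not_le of_nat_0 zero_less_numeral)
  have kraft: "(\<Sum>i<n. a i) \<le> N" for n
  proof -
    have "(\<Sum>i<n. a i) \<le> (\<Sum>i\<le>n. a i)" by (intro sum_mono2) (auto simp: a_def)
    also have "\<dots> = (\<Sum>i\<le>n. real (card (walks M i)) / real t ^ i) / real t"
      by (simp add: a_def sum_divide_distrib mult.commute)
    also have "\<dots> \<le> real t * real (card X) / real t"
      using sum_walks[OF mM, of n] tp by (intro divide_right_mono) auto
    finally show ?thesis using tp by (simp add: N_def)
  qed
  have aN: "a i \<le> N" for i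
  proof -
    have "a i \<le> (\<Sum>j<Suc i. a j)" by (auto simp: a_def intro!: sum_nonneg)
    then show ?thesis using kraft[of "Suc i"] by linarith
  qed
  have step: "a (Suc i) \<ge> a i - w i - N * real L / real t" if i: "i < L" for i
  proof -
    have "real L \<le> 4 * (real L)\<^sup>2 / \<epsilon>"
    proof -
      have "1 * real L \<le> (4 / \<epsilon>) * (real L * real L)"
      proof (intro mult_mono)
        show "1 \<le> 4 / \<epsilon>" using eps by (simp add: field_simps)
        show "real L \<le> real L * real L" using L0 by simp
      qed (use eps in auto)
      then show ?thesis by (simp add: power2_eq_square)
    qed
    then have "L \<le> t" using t by simp
    then have it: "Suc i \<le> t" using i by simp
    have sub: "card (aug_walks M i) \<le> card (walks M i)"
      using finite_walks by (intro card_mono) (auto simp: aug_walks_def)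
    have "real ((card (walks M i) - card (aug_walks M i)) * (t - Suc i)) \<le> real (card (walks M (Suc i)))"
      using card_walks_Suc[OF mM, of i] by (simp only: of_nat_le_iff)
    then have 1: "(real (card (walks M i)) - real (card (aug_walks M i))) * (real t - real (Suc i))
        \<le> real (card (walks M (Suc i)))"
      using sub it by (simp only: of_nat_mult of_nat_diff)
    have "(a i - w i) * (1 - real (Suc i) / real t)
       = ((real (card (walks M i)) - real (card (aug_walks M i))) * (real t - real (Suc i))) / real t ^ Suc (Suc i)"
      using tp by (simp add: a_def w_def field_simps)
    also have "\<dots> \<le> a (Suc i)" unfolding a_def by (intro divide_right_mono 1) auto
    finally have 2: "(a i - w i) * (1 - real (Suc i) / real t) \<le> a (Suc i)" .
    have "(a i - w i) * (real (Suc i) / real t) \<le> N * (real L / real t)"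
    proof (rule mult_mono)
      show "a i - w i \<le> N" using aN[of i] by (auto simp: w_def intro: order_trans[rotated])
      show "real (Suc i) / real t \<le> real L / real t" using i by (intro divide_right_mono) auto
    qed (auto simp: N_def)
    with 2 show ?thesis by (simp add: algebra_simps)
  qed
  define B where "B = (\<Sum>i<L. w i)"
  have low: "a j \<ge> \<epsilon> * N - (\<Sum>i<j. w i) - N * real L * real j / real t" if "j \<le> L" for j
    using that
  proof (induction j)
    case 0
    have "a 0 = real (card X - k)" using card_walks_0[OF M] tp by (simp add: a_def)
    then show ?case using k card_X_matched(2)[OF M] by (simp add: N_def algebra_simps)
  next
    case (Suc j)
    have "a (Suc j) \<ge> \<epsilon> * N - (\<Sum>i<j. w i) - N * real L * real j / real t - w j - N * real L / real t"
      using Suc step[of j] by fastforce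
    then show ?case by (simp add: algebra_simps add_divide_distrib)
  qed
  have low': "a j \<ge> \<epsilon> * N - B - N * real L * real L / real t" if "j < L" for j
  proof -
    have "(\<Sum>i<j. w i) \<le> B" unfolding B_def using that by (intro sum_mono2) (auto simp: w_def)
    moreover have "N * real L * real j / real t \<le> N * real L * real L / real t"
      using that tp by (intro divide_right_mono mult_left_mono) (auto simp: N_def)
    ultimately show ?thesis using low[of j] that by linarith
  qed
  \<comment> \<open>The \<open>L\<close> numbers \<open>a j\<close> share a common lower bound while
    their sum is at most \<open>N\<close>. The hypotheses on \<open>L\<close> and \<open>t\<close>
    make each of the two error terms at most \<open>\<epsilon> * N / 4\<close>, which leaves half of
    \<open>\<epsilon> * N\<close> for \<open>B\<close>.\<close>
  have "real L * (\<epsilon> * N - B - N * real L * real L / real t) \<le> (\<Sum>j<L. a j)"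
    using sum_mono[of "{..<L}" "\<lambda>_. \<epsilon> * N - B - N * real L * real L / real t" a] low' by simp
  also have "\<dots> \<le> N" by (rule kraft)
  finally have "\<epsilon> * N - B - N * real L * real L / real t \<le> N / real L"
    using L0 by (simp add: field_simps)
  moreover have "N / real L \<le> \<epsilon> * N / 4"
  proof -
    have "1 / real L \<le> \<epsilon> / 4" using L eps L0 by (simp add: field_simps)
    then show ?thesis using mult_left_mono[of "1 / real L" "\<epsilon> / 4" N] by (simp add: N_def field_simps)
  qed
  moreover have "N * real L * real L / real t \<le> \<epsilon> * N / 4"
  proof -
    have "real L * real L / real t \<le> \<epsilon> / 4"
      using t eps tp by (simp add: field_simps power2_eq_square)
    then show ?thesis using mult_left_mono[of "real L * real L / real t" "\<epsilon> / 4" N] by (simp add: N_def field_simps)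
  qed
  ultimately show ?thesis unfolding B_def w_def N_def by linarith
qed

text \<open>Double counting of augmenting walks, weighted by length: every \<open>k\<close>-matching
  contributes at least \<open>\<epsilon> * card X / 2\<close>, while each of the \<open>L\<close>
  lengths contributes at most \<open>card (matchings (Suc k)) * card X / t\<close> in total.\<close>

lemma card_matchings_Suc:
  assumes eps: "0 < \<epsilon>" "\<epsilon> \<le> 1" and X: "X \<noteq> {}" and k: "real k \<le> (1 - \<epsilon>) * real (card X)"
    and L: "real L \<ge> 4 / \<epsilon>" and t: "real t \<ge> 4 * (real L)\<^sup>2 / \<epsilon>"
  shows "real (card (matchings (Suc k))) \<ge> (real t * \<epsilon> / (2 * real L)) * real (card (matchings k))"
proof -
  have N: "real (card X) > 0" using X fin by (simp add: card_gt_0_iff)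
  have tp: "real t > 0" using t_pos by simp
  have L0: "L > 0" using L eps(1) by (metis divide_pos_pos gr0I not_le of_nat_0 zero_less_numeral)
  have "real (card (matchings k)) * (\<epsilon> * real (card X) / 2)
      \<le> (\<Sum>M\<in>matchings k. \<Sum>i<L. real (card (aug_walks M i)) / real t ^ Suc i)"
    using sum_mono[of "matchings k" "\<lambda>_. \<epsilon> * real (card X) / 2"] aug_walks_mass[OF _ eps k L t] by simp
  also have "\<dots> = (\<Sum>i<L. \<Sum>M\<in>matchings k. real (card (aug_walks M i)) / real t ^ Suc i)"
    by (rule sum.swap)
  also have "\<dots> = (\<Sum>i<L. real (\<Sum>M\<in>matchings k. card (aug_walks M i)) / real t ^ Suc i)"
    by (simp add: sum_divide_distrib)
  also have "\<dots> \<le> (\<Sum>i<L. real (card (matchings (Suc k)) * (card X * t ^ i)) / real t ^ Suc i)"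
    by (intro sum_mono divide_right_mono) (use sum_aug_walks in \<open>auto simp del: of_nat_sum of_nat_mult\<close>)
  also have "\<dots> = real L * real (card (matchings (Suc k))) * real (card X) / real t"
    using tp by simp
  finally have "real (card X) * (real (card (matchings k)) * \<epsilon> * real t)
     \<le> real (card X) * (2 * real L * real (card (matchings (Suc k))))"
    using tp by (simp add: field_simps)
  then have "real (card (matchings k)) * \<epsilon> * real t \<le> 2 * real L * real (card (matchings (Suc k)))"
    using N by simp
  then show ?thesis using L0 by (simp add: field_simps)
qed

text \<open>The ratio bound is iterated from the empty matching. It needs a proportion \<epsilon> of
  unmatched vertices at each step, hence almost perfect instead of perfect matchings.\<close>

theorem card_matchings_ge:
  assumes eps: "0 < \<epsilon>" "\<epsilon> \<le> 1" and X: "X \<noteq> {}" and k: "real k \<le> (1 - \<epsilon>) * real (card X)"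
    and L: "real L \<ge> 4 / \<epsilon>" and t: "real t \<ge> 4 * (real L)\<^sup>2 / \<epsilon>"
  shows "real (card (matchings k)) \<ge> (real t * \<epsilon> / (2 * real L)) ^ k"
  using k
proof (induction k)
  case 0
  have "matchings 0 = {{}}" using finite_matching by (auto simp: matchings_def matching_def)
  then show ?case by simp
next
  case (Suc k)
  have k: "real k \<le> (1 - \<epsilon>) * real (card X)" using Suc.prems by simp
  have "(real t * \<epsilon> / (2 * real L)) ^ Suc k \<le> (real t * \<epsilon> / (2 * real L)) * real (card (matchings k))"
    using mult_left_mono[OF Suc.IH[OF k], of "real t * \<epsilon> / (2 * real L)"] eps by simp
  also have "\<dots> \<le> real (card (matchings (Suc k)))" by (rule card_matchings_Suc[OF eps X k L t])
  finally show ?case .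
qed

end

section \<open>Creating families of Hamilton paths\<close>

definition orderings :: "nat \<Rightarrow> nat list set" where
  "orderings n = {xs. distinct xs \<and> set xs = {0..<n}}"

definition creating :: "nat \<Rightarrow> nat set set set \<Rightarrow> bool" where
  "creating m F \<longleftrightarrow> (\<forall>P\<in>F. \<forall>Q\<in>F. P \<noteq> Q \<longrightarrow> contains_cycle (P \<union> Q) m)"

definition pairs :: "'a list \<Rightarrow> ('a \<times> 'a) set" where
  "pairs xs = {(xs ! i, xs ! Suc i) | i. Suc i < length xs}"

lemma pairs_alt: "pairs xs = (\<lambda>i. (xs ! i, xs ! Suc i)) ` {i. Suc i < length xs}"
  unfolding pairs_def by auto

lemma finite_less_Suc: "finite {i. Suc i < k}" "card {i. Suc i < k} = k - 1"
proof -
  have "{i. Suc i < k} = {..<k - 1}" by auto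
  then show "finite {i. Suc i < k}" "card {i. Suc i < k} = k - 1" by auto
qed

lemma finite_pairs: "finite (pairs xs)" and card_pairs: "card (pairs xs) \<le> length xs - 1"
  using finite_less_Suc[of "length xs"] card_image_le[of "{i. Suc i < length xs}" "\<lambda>i. (xs ! i, xs ! Suc i)"]
  unfolding pairs_alt by auto

lemma path_edges_pairs: "path_edges xs = (\<lambda>(u, v). {u, v}) ` pairs xs"
  unfolding path_edges_def pairs_alt by auto

lemma ham_paths_orderings: "ham_paths n = path_edges ` orderings n"
  unfolding ham_paths_def orderings_def by auto

lemma orderings_length: "xs \<in> orderings n \<Longrightarrow> length xs = n"
  unfolding orderings_def using distinct_card by fastforce

lemma finite_orderings: "finite (orderings n)"
  by (rule finite_subset[OF _ finite_lists_length_eq[of "{0..<n}" n]])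
    (use orderings_length in \<open>auto simp: orderings_def\<close>)

lemma H_cycle_le:
  assumes "\<And>F. F \<subseteq> ham_paths n \<Longrightarrow> creating m F \<Longrightarrow> real (card F) \<le> B"
  shows "real (H_cycle n m) \<le> B"
proof -
  let ?S = "{card F | F. F \<subseteq> ham_paths n \<and> creating m F}"
  have fin: "finite (ham_paths n)" unfolding ham_paths_orderings using finite_orderings by simp
  have "finite ?S" using fin by (intro finite_subset[of ?S "card ` Pow (ham_paths n)"]) auto
  moreover have "card {} \<in> ?S" by (intro CollectI exI[of _ "{}"]) (simp add: creating_def)
  ultimately have "Max ?S \<in> ?S" by (intro Max_in) auto
  then obtain F where "F \<subseteq> ham_paths n" "creating m F" "Max ?S = card F" by blast
  then show ?thesis using assms unfolding H_cycle_def creating_def by metis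
qed

section \<open>Averaging over the symmetric group\<close>

lemma path_edges_map: "path_edges (map f xs) = (`) f ` path_edges xs"
  unfolding path_edges_pairs pairs_alt image_image by (intro image_cong) auto

lemma contains_cycle_image:
  assumes "contains_cycle E m" "inj f"
  shows "contains_cycle ((`) f ` E) m"
proof -
  obtain vs where vs: "length vs = m" "distinct vs" "\<forall>i<m. {vs ! i, vs ! ((Suc i) mod m)} \<in> E"
    using assms(1) unfolding contains_cycle_def by auto
  show ?thesis unfolding contains_cycle_def
  proof (intro exI[of _ "map f vs"] conjI allI impI)
    fix i assume "i < m"
    then have "Suc i mod m < m" by simp
    then have "{map f vs ! i, map f vs ! (Suc i mod m)} = f ` {vs ! i, vs ! (Suc i mod m)}"
      using vs(1) \<open>i < m\<close> by simp
    then show "{map f vs ! i, map f vs ! (Suc i mod m)} \<in> (`) f ` E"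
      using vs(3) \<open>i < m\<close> by blast
  qed (use vs assms(2) in \<open>auto simp: distinct_map intro: inj_on_subset\<close>)
qed

lemma permutes_map_ordering:
  assumes "ys \<in> orderings n" "zs \<in> orderings n"
  shows "\<exists>\<pi>. \<pi> permutes {0..<n} \<and> map \<pi> ys = zs"
proof -
  have b: "bij_betw ((!) xs) {0..<n} {0..<n}" if "xs \<in> orderings n" for xs
  proof (rule bij_betw_nth)
    show "distinct xs" "{0..<n} = set xs" using that unfolding orderings_def by simp_all
    show "{0..<n} = {..<length xs}" unfolding orderings_length[OF that] by (rule atLeast0LessThan)
  qed
  define \<pi> where "\<pi> i = (if i \<in> {0..<n} then zs ! (inv_into {0..<n} ((!) ys) i) else i)" for i
  have "bij_betw ((!) zs \<circ> inv_into {0..<n} ((!) ys)) {0..<n} {0..<n}"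
    by (rule bij_betw_trans[OF bij_betw_inv_into[OF b[OF assms(1)]] b[OF assms(2)]])
  then have "bij_betw \<pi> {0..<n} {0..<n}" 
    by (rule bij_betw_cong[THEN iffD1, rotated]) (auto simp: \<pi>_def)
  then have "\<pi> permutes {0..<n}" by (rule bij_imp_permutes) (auto simp: \<pi>_def)
  moreover have "map \<pi> ys = zs"
  proof (rule nth_equalityI)
    show "length (map \<pi> ys) = length zs" using assms orderings_length by simp
  next
    fix i assume "i < length (map \<pi> ys)"
    then have i: "i < n" "i < length ys" using orderings_length[OF assms(1)] by auto
    have "ys ! i \<in> {0..<n}" using assms(1) i by (metis (mono_tags, lifting) mem_Collect_eq nth_mem orderings_def)
    moreover have "inv_into {0..<n} ((!) ys) (ys ! i) = i"
      using b[OF assms(1)] i by (intro inv_into_f_f) (auto simp: bij_betw_def)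
    ultimately show "map \<pi> ys ! i = zs ! i" using i by (simp add: \<pi>_def)
  qed
  ultimately show ?thesis by blast
qed

text \<open>The clique--coclique inequality for the action of the symmetric group on Hamilton paths,
  with a bound \<open>K\<close> for the size of a creating family inside \<open>J\<close> in place of 1.\<close>

lemma card_creating_mult_le:
  assumes F: "F \<subseteq> ham_paths n" "creating m F" and J: "J \<subseteq> orderings n"
    and K: "\<And>F'. F' \<subseteq> path_edges ` J \<Longrightarrow> creating m F' \<Longrightarrow> card F' \<le> K"
  shows "card F * card J \<le> fact n * K"
proof -
  have finF: "finite F" using F(1) finite_orderings finite_subset unfolding ham_paths_orderings by blast
  have finJ: "finite J" using J finite_orderings finite_subset by blast
  obtain ys where ys: "ys P \<in> orderings n" "path_edges (ys P) = P" if "P \<in> F" for P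
  proof -
    have "\<forall>P\<in>F. \<exists>y. y \<in> orderings n \<and> path_edges y = P" using F(1) unfolding ham_paths_orderings by blast
    then show ?thesis using that by metis
  qed
  define S where "S \<pi> = {P \<in> F. map \<pi> (ys P) \<in> J}" for \<pi>
  let ?Perm = "{\<pi>. \<pi> permutes {0..<n}}"
  have finP: "finite ?Perm" by (simp add: finite_permutations)
  define p where "p P zs = (SOME \<pi>. \<pi> permutes {0..<n} \<and> map \<pi> (ys P) = zs)" for P zs
  have p: "p P zs permutes {0..<n}" "map (p P zs) (ys P) = zs" if "P \<in> F" "zs \<in> J" for P zs
    using someI_ex[OF permutes_map_ordering[of "ys P" n zs]] ys[OF that(1)] that J unfolding p_def by auto
  \<comment> \<open>Double counting: for each \<open>P\<close> and \<open>zs\<close> some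
    permutation carries the chosen ordering of \<open>P\<close> to \<open>zs\<close>, and this
    permutation together with \<open>P\<close> gives back \<open>zs\<close>.\<close>
  have "card (F \<times> J) \<le> card (Sigma ?Perm S)"
  proof (rule card_inj_on_le[of "\<lambda>(P, zs). (p P zs, P)"])
    show "inj_on (\<lambda>(P, zs). (p P zs, P)) (F \<times> J)"
      by (rule inj_onI) (clarsimp, metis p(2))
    show "(\<lambda>(P, zs). (p P zs, P)) ` (F \<times> J) \<subseteq> Sigma ?Perm S"
      using p by (auto simp: S_def)
    show "finite (Sigma ?Perm S)" using finP finF by (intro finite_SigmaI) (auto simp: S_def)
  qed
  also have "card (Sigma ?Perm S) = (\<Sum>\<pi>\<in>?Perm. card (S \<pi>))"
    using finP finF by (intro card_SigmaI) (auto simp: S_def)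
  also have "\<dots> \<le> (\<Sum>\<pi>\<in>?Perm. K)"
  proof (rule sum_mono)
    fix \<pi> assume "\<pi> \<in> ?Perm"
    then have inj: "inj \<pi>" using permutes_inj by auto
    let ?g = "(`) ((`) \<pi>)"
    have inj': "inj ?g" using inj by (simp add: inj_image_eq_iff inj_on_def)
    have "?g ` S \<pi> \<subseteq> path_edges ` J"
    proof
      fix Q assume "Q \<in> ?g ` S \<pi>"
      then obtain P where P: "P \<in> F" "map \<pi> (ys P) \<in> J" "Q = ?g P" by (auto simp: S_def)
      then have "Q = path_edges (map \<pi> (ys P))" using ys[OF P(1)] by (simp add: path_edges_map)
      then show "Q \<in> path_edges ` J" using P by blast
    qed
    moreover have "creating m (?g ` S \<pi>)"
      unfolding creating_def
    proof (intro ballI impI)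
      fix P Q assume "P \<in> ?g ` S \<pi>" "Q \<in> ?g ` S \<pi>" "P \<noteq> Q"
      then obtain P' Q' where h: "P' \<in> F" "Q' \<in> F" "P = ?g P'" "Q = ?g Q'" "P' \<noteq> Q'"
        by (auto simp: S_def)
      then have "contains_cycle (P' \<union> Q') m" using F(2) unfolding creating_def by blast
      from contains_cycle_image[OF this inj] show "contains_cycle (P \<union> Q) m"
        using h by (simp add: image_Un)
    qed
    ultimately have "card (?g ` S \<pi>) \<le> K" by (rule K)
    then show "card (S \<pi>) \<le> K" using card_image[of ?g "S \<pi>"] inj' by (metis inj_on_subset subset_UNIV)
  qed
  also have "\<dots> = fact n * K" using card_permutations[of "{0..<n}" n] by simp
  finally show ?thesis by (simp add: card_cartesian_product)
qed

text \<open>Take the vertex of the cycle that comes last on the path. Both its neighbours on the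
  cycle would have to be its predecessor on the path, so they would coincide, which
  \<open>m \<ge> 3\<close> excludes.\<close>

lemma path_edges_no_cycle:
  assumes "distinct zs" "m \<ge> 3"
  shows "\<not> contains_cycle (path_edges zs) m"
proof
  assume "contains_cycle (path_edges zs) m"
  then obtain vs where vs: "length vs = m" "distinct vs"
    "\<And>i. i < m \<Longrightarrow> {vs ! i, vs ! ((Suc i) mod m)} \<in> path_edges zs"
    unfolding contains_cycle_def by auto
  have "\<exists>a b. {vs ! i, vs ! (Suc i mod m)} = {zs ! a, zs ! b} \<and> a < length zs \<and> b < length zs \<and> (b = Suc a)" if "i < m" for i
    using vs(3)[OF that] unfolding path_edges_def by force
  then have pos: "\<exists>a b. vs ! i = zs ! a \<and> vs ! (Suc i mod m) = zs ! b \<and> a < length zs \<and> b < length zs \<and> (b = Suc a \<or> a = Suc b)"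
    if "i < m" for i using that by (metis doubleton_eq_iff)
  obtain q where q: "\<And>i. i < m \<Longrightarrow> q i < length zs \<and> zs ! q i = vs ! i"
    using pos by metis
  have adj: "q (Suc i mod m) = Suc (q i) \<or> q i = Suc (q (Suc i mod m))" if "i < m" for i
  proof -
    have "Suc i mod m < m" using that by simp
    with pos[OF that] q[OF that] q[of "Suc i mod m"] show ?thesis
      using assms(1) nth_eq_iff_index_eq by metis
  qed
  have inj: "i = j" if "i < m" "j < m" "q i = q j" for i j
    using that q vs(1,2) nth_eq_iff_index_eq by metis
  have "finite (q ` {..<m})" "q ` {..<m} \<noteq> {}" using assms(2) by (auto simp: lessThan_empty_iff)
  from Max_in[OF this] obtain i where i: "i < m" "q i = Max (q ` {..<m})" by auto
  have mx: "q j \<le> q i" if "j < m" for j using that i by simp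
  define h where "h = (if i = 0 then m - 1 else i - 1)"
  have h: "h < m" "Suc h mod m = i" using i assms(2) unfolding h_def by (auto simp: mod_Suc)
  have s: "Suc i mod m < m" using i by simp
  have "q i = Suc (q (Suc i mod m))" using adj[OF i(1)] mx[OF s] by auto
  moreover have "q i = Suc (q h)" using adj[OF h(1)] h mx[OF h(1)] by auto
  ultimately have "h = Suc i mod m" using inj[OF h(1) s] by simp
  then show False using i assms(2) unfolding h_def by (auto simp: mod_Suc split: if_splits)
qed

section \<open>Paths with few edges outside a graph\<close>

definition grow :: "'a set set \<Rightarrow> 'a set set \<Rightarrow> 'a set set" where
  "grow P B = B \<union> {e \<in> P. \<exists>e'\<in>B. e \<inter> e' \<noteq> {}}"

text \<open>The ball of radius \<open>i\<close> around the edges outside \<open>G\<close>, in the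
  line graph of the path \<open>P\<close>.\<close>

definition near :: "'a set set \<Rightarrow> 'a set set \<Rightarrow> nat \<Rightarrow> 'a set set" where
  "near G P i = (grow P ^^ i) (P - G)"

lemma near_simps: "near G P 0 = P - G" "near G P (Suc i) = grow P (near G P i)"
  unfolding near_def by auto

lemma near_subset: "near G P i \<subseteq> P"
  by (induction i) (auto simp: near_simps grow_def)

lemma near_mono: "i \<le> j \<Longrightarrow> near G P i \<subseteq> near G P j"
  by (rule lift_Suc_mono_le) (auto simp: near_simps grow_def)

lemma card_adjacent_le:
  assumes "distinct zs" "e \<in> path_edges zs"
  shows "card {f \<in> path_edges zs. f \<inter> e \<noteq> {}} \<le> 3"
proof -
  obtain i where i: "e = {zs ! i, zs ! Suc i}" "Suc i < length zs"
    using assms(2) unfolding path_edges_def by auto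
  let ?f = "\<lambda>j. {zs ! j, zs ! Suc j}"
  \<comment> \<open>An edge, its predecessor and its successor. For \<open>i = 0\<close> the index
    \<open>i - 1\<close> is \<open>0\<close> again, which only shrinks the set.\<close>
  have "{f \<in> path_edges zs. f \<inter> e \<noteq> {}} \<subseteq> ?f ` {i - 1, i, Suc i}"
  proof
    fix f assume "f \<in> {f \<in> path_edges zs. f \<inter> e \<noteq> {}}"
    then obtain j where j: "f = ?f j" "Suc j < length zs" "f \<inter> e \<noteq> {}"
      unfolding path_edges_def by auto
    then have "zs ! j = zs ! i \<or> zs ! j = zs ! Suc i \<or> zs ! Suc j = zs ! i \<or> zs ! Suc j = zs ! Suc i"
      using i by auto
    then have "j \<in> {i - 1, i, Suc i}"
      using i(2) j(2) assms(1) by (auto simp: nth_eq_iff_index_eq)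
    then show "f \<in> ?f ` {i - 1, i, Suc i}" using j(1) by blast
  qed
  then have "card {f \<in> path_edges zs. f \<inter> e \<noteq> {}} \<le> card (?f ` {i - 1, i, Suc i})"
    by (intro card_mono) auto
  also have "\<dots> \<le> card {i - 1, i, Suc i}" by (rule card_image_le) simp
  also have "\<dots> \<le> 3" using card_length[of "[i - 1, i, Suc i]"] by simp
  finally show ?thesis .
qed

lemma card_near_le:
  assumes "distinct zs"
  shows "card (near G (path_edges zs) i) \<le> 3 ^ i * card (path_edges zs - G)"
proof (induction i)
  case (Suc i)
  let ?P = "path_edges zs" and ?B = "near G (path_edges zs) i"
  have finP: "finite ?P" unfolding path_edges_pairs by (rule finite_imageI[OF finite_pairs])
  have finB: "finite ?B" using near_subset finP finite_subset by metis
  have "e \<noteq> {}" if "e \<in> ?P" for e using that unfolding path_edges_def by auto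
  then have ne: "e \<inter> e \<noteq> {}" if "e \<in> ?B" for e
    using near_subset[of G ?P i] that by (metis inf.idem subsetD)
  have "grow ?P ?B \<subseteq> (\<Union>e\<in>?B. {f \<in> ?P. f \<inter> e \<noteq> {}})"
  proof
    fix f assume "f \<in> grow ?P ?B"
    then consider "f \<in> ?B" | "f \<in> ?P" "\<exists>e\<in>?B. f \<inter> e \<noteq> {}" unfolding grow_def by auto
    then show "f \<in> (\<Union>e\<in>?B. {f \<in> ?P. f \<inter> e \<noteq> {}})"
    proof cases
      case 1
      then have "f \<in> {f' \<in> ?P. f' \<inter> f \<noteq> {}}" using ne[OF 1] near_subset by (metis (mono_tags, lifting) mem_Collect_eq subsetD)
      with 1 show ?thesis by (rule UN_I)
    next
      case 2
      then obtain e where "e \<in> ?B" "f \<inter> e \<noteq> {}" by auto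
      then show ?thesis using 2(1) by (intro UN_I[of e]) simp_all
    qed
  qed
  then have "card (grow ?P ?B) \<le> card (\<Union>e\<in>?B. {f \<in> ?P. f \<inter> e \<noteq> {}})"
    using finB finP by (intro card_mono) auto
  also have "\<dots> \<le> (\<Sum>e\<in>?B. card {f \<in> ?P. f \<inter> e \<noteq> {}})" by (rule card_UN_le[OF finB])
  also have "\<dots> \<le> (\<Sum>e\<in>?B. 3)"
    using near_subset[of G ?P i] by (intro sum_mono card_adjacent_le assms) auto
  also have "\<dots> = 3 * card ?B" by simp
  finally show ?case using Suc by (simp add: near_simps)
qed (simp add: near_simps)

text \<open>If two paths agree near their edges outside \<open>G\<close>, then a short closed walk in their union that
  uses such an edge never leaves the common part.\<close>

lemma near_inj:
  assumes G: "\<not> contains_cycle G m" and m: "m \<ge> 3" and PQ: "P = path_edges zs" "distinct zs"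
    and eq: "near G P m = near G Q m"
  shows "\<not> contains_cycle (P \<union> Q) m"
proof
  assume "contains_cycle (P \<union> Q) m"
  then obtain vs where vs: "length vs = m" "distinct vs"
    "\<And>i. i < m \<Longrightarrow> {vs ! i, vs ! ((Suc i) mod m)} \<in> P \<union> Q"
    unfolding contains_cycle_def by auto
  define E where "E i = {vs ! (i mod m), vs ! (Suc i mod m)}" for i
  have E: "E i \<in> P \<union> Q" for i
    using vs(3)[of "i mod m"] m unfolding E_def by (simp add: mod_Suc_eq)
  obtain i0 where i0: "E i0 \<notin> G"
  proof -
    have "\<exists>i<m. E i \<notin> G"
    proof (rule ccontr)
      assume "\<not> ?thesis"
      then have "contains_cycle G m" unfolding contains_cycle_def
        using vs(1,2) by (intro exI[of _ vs]) (auto simp: E_def)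
      with G show False by simp
    qed
    then show ?thesis using that by auto
  qed
  have sub: "near G P i \<subseteq> P \<inter> Q" "near G Q i \<subseteq> P \<inter> Q" if "i \<le> m" for i
    using near_mono[OF that, of G P] near_mono[OF that, of G Q] near_subset[of G P m] near_subset[of G Q m] eq
    by auto
  \<comment> \<open>Going round the cycle from an edge outside \<open>G\<close>, the next edge meets
    the current one, which is near in both paths. It is therefore near in whichever path contains
    it, hence common to both, and so near in both. After \<open>m\<close> steps the whole cycle lies
    in \<open>P\<close>.\<close>
  have "j \<le> m \<longrightarrow> E (i0 + j) \<in> near G P j \<inter> near G Q j" for j
  proof (induction j)
    case 0
    have "E i0 \<in> near G P 0 \<or> E i0 \<in> near G Q 0" using E[of i0] i0 by (auto simp: near_simps)
    then have "E i0 \<in> P \<inter> Q" using sub[of 0] by auto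
    then show ?case using i0 by (auto simp: near_simps)
  next
    case (Suc j)
    show ?case
    proof
      assume j: "Suc j \<le> m"
      then have IH: "E (i0 + j) \<in> near G P j" "E (i0 + j) \<in> near G Q j" using Suc by auto
      have meet: "E (i0 + Suc j) \<inter> E (i0 + j) \<noteq> {}" unfolding E_def by auto
      have "E (i0 + Suc j) \<in> near G P (Suc j) \<or> E (i0 + Suc j) \<in> near G Q (Suc j)"
        using E[of "i0 + Suc j"] IH meet by (auto simp: near_simps grow_def)
      then have "E (i0 + Suc j) \<in> P \<inter> Q" using sub[OF j] by auto
      then show "E (i0 + Suc j) \<in> near G P (Suc j) \<inter> near G Q (Suc j)"
        using IH meet by (auto simp: near_simps grow_def)
    qed
  qed
  then have *: "E (i0 + j) \<in> P" if "j \<le> m" for j using that near_subset by fastforce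
  have "E i \<in> P" if "i < m" for i
  proof -
    have "\<exists>j\<le>m. (i0 + j) mod m = i"
    proof (intro exI conjI)
      let ?r = "i0 mod m"
      have r: "?r < m" using m by simp
      show "(i + (m - ?r)) mod m \<le> m" using m by (simp add: less_imp_le)
      have "(i0 + (i + (m - ?r)) mod m) mod m = (?r + (i + (m - ?r))) mod m" by (simp add: mod_add_left_eq mod_add_right_eq)
      also have "?r + (i + (m - ?r)) = i + m" using r by simp
      also have "(i + m) mod m = i" using that by simp
      finally show "(i0 + (i + (m - ?r)) mod m) mod m = i" .
    qed
    then obtain j where j: "j \<le> m" "(i0 + j) mod m = i" by auto
    have "E (i0 + j) = E i" using j(2) that unfolding E_def by (metis mod_Suc_eq mod_less)
    with *[OF j(1)] show ?thesis by simp
  qed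
  then have "contains_cycle P m" unfolding contains_cycle_def
    using vs(1,2) by (intro exI[of _ vs]) (auto simp: E_def)
  then show False using path_edges_no_cycle[OF PQ(2) m] PQ(1) by simp
qed

lemma card_small_subsets_le:
  assumes "finite A"
  shows "card {S. S \<subseteq> A \<and> card S \<le> r} \<le> (card A + 1) ^ r"
proof (induction r)
  case 0
  have "{S. S \<subseteq> A \<and> card S \<le> 0} \<subseteq> {{}}" using assms finite_subset by fastforce
  then have "card {S. S \<subseteq> A \<and> card S \<le> 0} \<le> card {{} :: 'a set}" by (rule card_mono[rotated]) simp
  then show ?case by simp
next
  case (Suc r)
  let ?C = "\<lambda>r. {S. S \<subseteq> A \<and> card S \<le> r}"
  have fin: "finite (?C r)" using assms by (intro finite_subset[of "?C r" "Pow A"]) auto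
  \<comment> \<open>The value \<open>None\<close> keeps the set and serves the empty set, to which
    no element can be traced back. This is the \<open>+ 1\<close> in the bound.\<close>
  let ?f = "\<lambda>(x, S). case x of None \<Rightarrow> S | Some a \<Rightarrow> insert a S"
  have "?C (Suc r) \<subseteq> ?f ` (insert None (Some ` A) \<times> ?C r)"
  proof
    fix S assume S: "S \<in> ?C (Suc r)"
    then have finS: "finite S" using assms finite_subset by auto
    show "S \<in> ?f ` (insert None (Some ` A) \<times> ?C r)"
    proof (cases "S = {}")
      case True
      then show ?thesis by (intro image_eqI[of _ _ "(None, {})"]) auto
    next
      case False
      then obtain a where "a \<in> S" by auto
      then show ?thesis using S finS by (intro image_eqI[of _ _ "(Some a, S - {a})"]) auto
    qed
  qed
  then have "card (?C (Suc r)) \<le> card (insert None (Some ` A) \<times> ?C r)"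
    using fin assms by (intro surj_card_le) auto
  also have "\<dots> = (card A + 1) * card (?C r)"
    using assms by (simp add: card_cartesian_product card_image)
  also have "\<dots> \<le> (card A + 1) ^ Suc r"
    using mult_le_mono2[OF Suc, of "card A + 1"] by simp
  finally show ?case .
qed

text \<open>By \<open>near_inj\<close> a path of \<open>F\<close> is determined by its edges near
  the complement of \<open>G\<close>, and these are at most \<open>3 ^ m * s\<close> in
  number.\<close>

lemma card_creating_few_bad_edges:
  assumes G: "\<not> contains_cycle G m" and m: "m \<ge> 3"
    and F: "F \<subseteq> path_edges ` {zs \<in> orderings n. card (path_edges zs - G) \<le> s}" "creating m F"
  shows "card F \<le> (n\<^sup>2 + 1) ^ (3 ^ m * s)"
proof -
  define A where "A = (\<lambda>(u, v). {u, v}) ` ({0..<n} \<times> {0..<n})"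
  have A: "finite A" "card A \<le> n\<^sup>2"
    using card_image_le[of "{0..<n} \<times> {0..<n}" "\<lambda>(u, v). {u, v}"]
    unfolding A_def by (auto simp: card_cartesian_product power2_eq_square)
  let ?C = "{S. S \<subseteq> A \<and> card S \<le> 3 ^ m * s}"
  have Fz: "\<exists>zs. P = path_edges zs \<and> distinct zs \<and> set zs = {0..<n} \<and> card (path_edges zs - G) \<le> s" if "P \<in> F" for P
    using that F(1) unfolding orderings_def by blast
  have "card F \<le> card ?C"
  proof (rule card_inj_on_le[of "\<lambda>P. near G P m"])
    show "inj_on (\<lambda>P. near G P m) F"
    proof (rule inj_onI, rule ccontr)
      fix P Q assume h: "P \<in> F" "Q \<in> F" "near G P m = near G Q m" "P \<noteq> Q"
      then have "contains_cycle (P \<union> Q) m" using F(2) unfolding creating_def by blast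
      moreover obtain zs where "P = path_edges zs" "distinct zs" using Fz[OF h(1)] by auto
      ultimately show False using near_inj[OF G m _ _ h(3)] by blast
    qed
    show "(\<lambda>P. near G P m) ` F \<subseteq> ?C"
    proof
      fix S assume "S \<in> (\<lambda>P. near G P m) ` F"
      then obtain P where P: "P \<in> F" "S = near G P m" by auto
      obtain zs where zs: "P = path_edges zs" "distinct zs" "set zs = {0..<n}" "card (path_edges zs - G) \<le> s"
        using Fz[OF P(1)] by auto
      have "path_edges zs \<subseteq> A"
      proof
        fix e assume "e \<in> path_edges zs"
        then obtain i where i: "e = {zs ! i, zs ! Suc i}" "Suc i < length zs" unfolding path_edges_def by auto
        then have "zs ! i \<in> {0..<n}" "zs ! Suc i \<in> {0..<n}" using zs(3) nth_mem Suc_lessD by metis+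
        then show "e \<in> A" unfolding A_def i(1) by blast
      qed
      then have "S \<subseteq> A" using near_subset[of G P m] P zs by auto
      moreover have "card S \<le> 3 ^ m * s"
        unfolding P(2) zs(1) by (rule order.trans[OF card_near_le[OF zs(2)] mult_le_mono2[OF zs(4)]])
      ultimately show "S \<in> ?C" by simp
    qed
    show "finite ?C" using A by (intro finite_subset[of ?C "Pow A"]) auto
  qed
  also have "\<dots> \<le> (card A + 1) ^ (3 ^ m * s)" by (rule card_small_subsets_le[OF A(1)])
  also have "\<dots> \<le> (n\<^sup>2 + 1) ^ (3 ^ m * s)" using A(2) by (intro power_mono) auto
  finally show ?thesis .
qed

section \<open>From linear forests to orderings\<close>

lemma pairs_insert:
  "pairs (as @ w # bs) - {(u, w) | u. True} \<subseteq> pairs (as @ v # w # bs)"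
  "(v, w) \<in> pairs (as @ v # w # bs)"
proof -
  show "(v, w) \<in> pairs (as @ v # w # bs)"
    unfolding pairs_def by (rule CollectI, rule exI[of _ "length as"]) (simp add: nth_append)
  show "pairs (as @ w # bs) - {(u, w) | u. True} \<subseteq> pairs (as @ v # w # bs)"
  proof
    fix z assume z: "z \<in> pairs (as @ w # bs) - {(u, w) | u. True}"
    then obtain i where i: "z = ((as @ w # bs) ! i, (as @ w # bs) ! Suc i)" "Suc i < length (as @ w # bs)"
      unfolding pairs_def by auto
    have "Suc i \<noteq> length as" using z i by (auto simp: nth_append)
    then consider "Suc i < length as" | "length as \<le> i" by linarith
    then show "z \<in> pairs (as @ v # w # bs)"
    proof cases
      case 1
      have "z = ((as @ v # w # bs) ! i, (as @ v # w # bs) ! Suc i)" using i(1) 1 by (simp add: nth_append)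
      moreover have "Suc i < length (as @ v # w # bs)" using i(2) by simp
      ultimately show ?thesis unfolding pairs_def by blast
    next
      case 2
      then have "z = ((as @ v # w # bs) ! Suc i, (as @ v # w # bs) ! Suc (Suc i))"
        using i(1) by (simp add: nth_append Suc_diff_le)
      moreover have "Suc (Suc i) < length (as @ v # w # bs)" using i(2) by simp
      ultimately show ?thesis unfolding pairs_def by blast
    qed
  qed
qed

lemma pairs_Cons: "pairs xs \<subseteq> pairs (x # xs)"
  unfolding pairs_def by force

text \<open>A source of the linear forest is inserted right before its successor, which has no other
  predecessor.\<close>

lemma linear_forest_extends:
  fixes rk :: "'a \<Rightarrow> nat"
  assumes "finite V" "S \<subseteq> V \<times> V" "inj_on fst S" "inj_on snd S" "\<And>u v. (u, v) \<in> S \<Longrightarrow> rk u < rk v"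
  shows "\<exists>zs. distinct zs \<and> set zs = V \<and> S \<subseteq> pairs zs"
  using assms
proof (induction V arbitrary: S rule: finite_psubset_induct)
  case (psubset V)
  show ?case
  proof (cases "V = {}")
    case True
    then show ?thesis using psubset.prems by auto
  next
    case False
    \<comment> \<open>The rank increases along \<open>S\<close>, so a vertex of least rank is a
      source.\<close>
    obtain v where v: "v \<in> V" "\<And>u. u \<in> V \<Longrightarrow> rk v \<le> rk u"
      using ex_min_if_finite[of "rk ` V"] psubset.hyps False by (metis (no_types, opaque_lifting) arg_min_if_finite(1) arg_min_least)
    define S' where "S' = {e \<in> S. fst e \<noteq> v}"
    have noin: "(u, v) \<notin> S" for u
      using v psubset.prems(1,4) by (metis SigmaD1 leD subsetD)
    have S'V: "S' \<subseteq> (V - {v}) \<times> (V - {v})" using psubset.prems(1) noin unfolding S'_def by auto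
    have "\<exists>zs. distinct zs \<and> set zs = V - {v} \<and> S' \<subseteq> pairs zs"
    proof (rule psubset.IH)
      show "inj_on fst S'" by (rule inj_on_subset[OF psubset.prems(2)]) (auto simp: S'_def)
      show "inj_on snd S'" by (rule inj_on_subset[OF psubset.prems(3)]) (auto simp: S'_def)
    qed (use v S'V psubset.prems in \<open>auto simp: S'_def\<close>)
    then obtain zs where zs: "distinct zs" "set zs = V - {v}" "S' \<subseteq> pairs zs" by auto
    show ?thesis
    proof (cases "\<exists>w. (v, w) \<in> S")
      case False
      then have "S = S'" unfolding S'_def by auto
      then show ?thesis using zs v pairs_Cons[of zs v] by (intro exI[of _ "v # zs"]) auto
    next
      case True
      then obtain w where w: "(v, w) \<in> S" by auto
      have "w \<in> set zs" using zs w noin psubset.prems(1) by auto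
      then obtain as bs where ab: "zs = as @ w # bs" by (meson split_list)
      have "S \<subseteq> insert (v, w) S'"
      proof
        fix e assume "e \<in> S"
        then show "e \<in> insert (v, w) S'"
          using w psubset.prems(2) unfolding S'_def inj_on_def by (cases "fst e = v") auto
      qed
      moreover have "S' \<inter> {(u, w) | u. True} = {}"
      proof (rule ccontr)
        assume "\<not> ?thesis"
        then obtain u where "(u, w) \<in> S" "u \<noteq> v" unfolding S'_def by auto
        then show False using inj_onD[OF psubset.prems(3), of "(u, w)" "(v, w)"] w by simp
      qed
      ultimately have "S \<subseteq> pairs (as @ v # w # bs)"
        using zs(3) pairs_insert[where w = w and v = v] unfolding ab by blast
      moreover have "distinct (as @ v # w # bs)" "set (as @ v # w # bs) = V"
        using zs v unfolding ab by auto
      ultimately show ?thesis by blast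
    qed
  qed
qed

text \<open>Each forest extends to an ordering, in which at most \<open>n - k\<close> of the
  consecutive pairs are not its edges. An ordering has fewer than \<open>n\<close> pairs if
  \<open>n > 0\<close>, so it arises from at most \<open>2 ^ n\<close> forests.\<close>

lemma card_linear_forests_le:
  fixes rk :: "nat \<Rightarrow> nat"
  assumes S: "\<And>S. S \<in> \<S> \<Longrightarrow> S \<subseteq> {0..<n} \<times> {0..<n} \<and> inj_on fst S \<and> inj_on snd S \<and> card S = k \<and>
      (\<forall>(u, v)\<in>S. rk u < rk v \<and> {u, v} \<in> G)"
  shows "card \<S> \<le> card {zs \<in> orderings n. card (path_edges zs - G) \<le> n - k} * 2 ^ n"
proof -
  let ?J = "{zs \<in> orderings n. card (path_edges zs - G) \<le> n - k}"
  let ?Q = "Sigma ?J (\<lambda>zs. Pow (pairs zs))"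
  have finJ: "finite ?J" using finite_orderings by simp
  have fQ: "finite ?Q" using finJ finite_pairs by (intro finite_SigmaI) auto
  have "\<S> \<subseteq> snd ` ?Q"
  proof
    fix S assume "S \<in> \<S>"
    note h = S[OF this]
    obtain zs where zs: "distinct zs" "set zs = {0..<n}" "S \<subseteq> pairs zs"
    proof -
      have "\<And>u v. (u, v) \<in> S \<Longrightarrow> rk u < rk v" using h by auto
      then show ?thesis using linear_forest_extends[of "{0..<n}" S rk] h that by blast
    qed
    then have zo: "zs \<in> orderings n" by (simp add: orderings_def)
    have "path_edges zs - G \<subseteq> (\<lambda>(u, v). {u, v}) ` (pairs zs - S)"
      using h unfolding path_edges_pairs by auto
    then have "card (path_edges zs - G) \<le> card (pairs zs - S)"
      using finite_pairs by (intro surj_card_le) auto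
    also have "\<dots> = card (pairs zs) - k"
      using h zs(3) finite_pairs finite_subset by (subst card_Diff_subset) auto
    also have "\<dots> \<le> n - k" using card_pairs[of zs] orderings_length[OF zo] by simp
    finally have "(zs, S) \<in> ?Q" using zo zs by simp
    then show "S \<in> snd ` ?Q" by (rule image_eqI[rotated]) simp
  qed
  then have "card \<S> \<le> card ?Q" using fQ by (rule surj_card_le[rotated])
  also have "\<dots> = (\<Sum>zs\<in>?J. card (Pow (pairs zs)))" using finJ finite_pairs by (intro card_SigmaI) auto
  also have "\<dots> \<le> (\<Sum>zs\<in>?J. 2 ^ n)"
  proof (rule sum_mono)
    fix zs assume "zs \<in> ?J"
    then have "card (pairs zs) \<le> n" using card_pairs[of zs] orderings_length[of zs n] by simp
    then show "card (Pow (pairs zs)) \<le> 2 ^ n"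
      unfolding card_Pow[OF finite_pairs] by (intro power_increasing) auto
  qed
  finally show ?thesis by simp
qed

section \<open>Primes in short multiplicative intervals\<close>

text \<open>Legendre's formula: passing from \<open>n\<close> to \<open>Suc n\<close> raises
  \<open>n div d\<close> exactly for the divisors \<open>d\<close> of \<open>Suc n\<close>. The free
  range \<open>N\<close> lets the cases of \<open>n\<close> and \<open>2 * n\<close> be subtracted
  term by term.\<close>

lemma ln_fact_mangoldt:
  assumes "n \<le> N"
  shows "ln (fact n :: real) = (\<Sum>d\<in>{1..N}. mangoldt d * real (n div d))"
  using assms
proof (induction n)
  case (Suc n)
  have "(\<Sum>d\<in>{1..N}. mangoldt d * real (Suc n div d))
      = (\<Sum>d\<in>{1..N}. mangoldt d * real (n div d) + (if d dvd Suc n then mangoldt d else 0))"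
    by (intro sum.cong refl) (auto simp: div_Suc dvd_eq_mod_eq_0 algebra_simps)
  also have "\<dots> = ln (fact n) + (\<Sum>d\<in>{1..N}. if d dvd Suc n then mangoldt d else 0)"
    using Suc by (simp add: sum.distrib)
  also have "(\<Sum>d\<in>{1..N}. if d dvd Suc n then mangoldt d else 0) = (\<Sum>d | d dvd Suc n. mangoldt d :: real)"
  proof -
    have "d \<in> {1..N}" if "d dvd Suc n" for d
      using dvd_imp_le[OF that] dvd_pos_nat[OF _ that] Suc.prems by simp
    then have "{d \<in> {1..N}. d dvd Suc n} = {d. d dvd Suc n}" by blast
    then show ?thesis by (simp add: sum.inter_filter[symmetric])
  qed
  also have "\<dots> = ln (real (Suc n))" using mangoldt_sum[of "Suc n", where 'a = real] by simp
  finally show ?case by (simp add: ln_mult add.commute)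
qed simp

text \<open>Chebyshev's argument: \<open>2 * n div d\<close> exceeds \<open>2 * (n div d)\<close> by
  at most 1.\<close>

lemma ln_central_binomial_le:
  "ln (real (2 * n choose n)) \<le> (\<Sum>d\<in>{1..2 * n}. mangoldt d)"
proof -
  have "real (2 * n choose n) = fact (2 * n) / (fact n * fact n)"
    by (simp add: binomial_fact)
  then have "ln (real (2 * n choose n)) = ln (fact (2 * n)) - 2 * ln (fact n)"
    by (simp add: ln_div ln_mult)
  also have "\<dots> = (\<Sum>d\<in>{1..2 * n}. mangoldt d * (real (2 * n div d) - 2 * real (n div d)))"
    using ln_fact_mangoldt[of "2 * n" "2 * n"] ln_fact_mangoldt[of n "2 * n"]
    by (simp add: sum_distrib_left sum_subtractf algebra_simps)
  also have "\<dots> \<le> (\<Sum>d\<in>{1..2 * n}. mangoldt d)"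
  proof (rule sum_mono)
    fix d assume "d \<in> {1..2 * n}"
    then have d: "d > 0" by simp
    have "2 * n div d \<le> 2 * (n div d) + 1"
    proof -
      have "2 * n < 2 * (n div d * d) + 2 * d"
        using div_mult_mod_eq[of n d] mod_less_divisor[OF d, of n] by linarith
      then have "2 * n < (2 * (n div d) + 2) * d" by (simp add: algebra_simps)
      then have "2 * n div d < 2 * (n div d) + 2" using d by (simp add: div_less_iff_less_mult)
      then show ?thesis by simp
    qed
    then have "real (2 * n div d) \<le> 2 * real (n div d) + 1" by linarith
    then have "mangoldt d * (real (2 * n div d) - 2 * real (n div d)) \<le> mangoldt d * 1"
      by (intro mult_left_mono mangoldt_nonneg) simp
    then show "mangoldt d * (real (2 * n div d) - 2 * real (n div d)) \<le> mangoldt d" by simp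
  qed
  finally show ?thesis .
qed

text \<open>The nonzero terms come from prime powers \<open>p ^ k\<close> with
  \<open>p \<le> y\<close> and \<open>k \<le> log 2 N\<close>, and each is at most
  \<open>ln N\<close>.\<close>

lemma sum_mangoldt_le:
  assumes "\<And>p. prime p \<Longrightarrow> p \<le> N \<Longrightarrow> p \<le> y" "N > 0"
  shows "(\<Sum>d\<in>{1..N}. mangoldt d :: real) \<le> real (Suc y) * (log 2 N + 1) * ln N"
proof -
  let ?A = "{d \<in> {1..N}. mangoldt d \<noteq> (0::real)}"
  let ?K = "nat \<lfloor>log 2 N\<rfloor>"
  have sub: "?A \<subseteq> (\<lambda>(p, k). p ^ k) ` ({..y} \<times> {..?K})"
  proof
    fix d assume d: "d \<in> ?A"
    then have "primepow d" by (auto simp: mangoldt_def split: if_splits)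
    then obtain p k where pk: "prime p" "k > 0" "d = p ^ k" unfolding primepow_def by auto
    have "p \<le> N" using d pk self_le_power[of p k] prime_gt_0_nat[OF pk(1)] by simp
    then have "p \<le> y" using assms pk by simp
    moreover have "k \<le> ?K"
    proof -
      have "(2::nat) ^ k \<le> p ^ k" using prime_ge_2_nat[OF pk(1)] by (rule power_mono) simp
      also have "p ^ k \<le> N" using d pk by simp
      finally have "2 ^ k \<le> N" .
      then have "(2::real) ^ k \<le> real N" by (metis of_nat_le_iff of_nat_numeral of_nat_power)
      then have "real k \<le> log 2 N" using assms(2) by (simp add: le_log_iff powr_realpow)
      then show ?thesis by linarith
    qed
    ultimately show "d \<in> (\<lambda>(p, k). p ^ k) ` ({..y} \<times> {..?K})"
      using pk by (intro image_eqI[of _ _ "(p, k)"]) auto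
  qed
  have "card ?A \<le> card ({..y} \<times> {..?K})"
    using sub by (intro surj_card_le) auto
  then have c: "card ?A \<le> Suc y * Suc ?K" by (simp add: card_cartesian_product)
  have lN: "log 2 N \<ge> 0" "ln N \<ge> 0" using assms(2) by simp_all
  have "(\<Sum>d\<in>{1..N}. mangoldt d :: real) = (\<Sum>d\<in>?A. mangoldt d)"
    by (rule sum.mono_neutral_right) auto
  also have "\<dots> \<le> (\<Sum>d\<in>?A. ln N)"
  proof (rule sum_mono)
    fix d assume d: "d \<in> ?A"
    then have "mangoldt d \<le> ln (real d)" using mangoldt_le[of d] by simp
    also have "\<dots> \<le> ln N" using d by simp
    finally show "mangoldt d \<le> ln (real N)" .
  qed
  also have "\<dots> = real (card ?A) * ln N" by simp
  also have "\<dots> \<le> real (Suc y * Suc ?K) * ln N"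
    using c lN by (intro mult_right_mono) (simp_all only: of_nat_le_iff)
  also have "\<dots> \<le> real (Suc y) * (log 2 N + 1) * ln N"
  proof -
    have "real (Suc ?K) \<le> log 2 N + 1" using lN by simp
    then show ?thesis using lN unfolding of_nat_mult by (intro mult_right_mono mult_left_mono) auto
  qed
  finally show ?thesis .
qed

text \<open>Were all primes up to \<open>2 * n\<close> below \<open>n powr (1 - \<epsilon>)\<close>,
  the sum of \<open>mangoldt\<close> would be too small for the central binomial coefficient, whose
  logarithm is about \<open>n * ln 4\<close>. Only the exponent of the prime matters later, so this
  wide interval is enough.\<close>

lemma eventually_prime_between:
  assumes "0 < \<epsilon>" "\<epsilon> < 1"
  shows "\<forall>\<^sub>F n in at_top. \<exists>p. prime p \<and> real n powr (1 - \<epsilon>) \<le> real p \<and> p \<le> 2 * n"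
proof -
  have "\<forall>\<^sub>F n in at_top. real n * ln 4 - ln (2 * real n) >
      (real n powr (1 - \<epsilon>) + 1) * (log 2 (2 * real n) + 1) * ln (2 * real n)"
    using assms by real_asymp
  then show ?thesis using eventually_gt_at_top[of 0]
  proof eventually_elim
    case (elim n)
    show ?case
    proof (rule ccontr)
      assume no: "\<not> ?thesis"
      let ?y = "nat \<lfloor>real n powr (1 - \<epsilon>)\<rfloor>"
      have "p \<le> ?y" if "prime p" "p \<le> 2 * n" for p
      proof -
        have "real p < real n powr (1 - \<epsilon>)" using no that by (meson not_le)
        then show ?thesis by linarith
      qed
      then have "(\<Sum>d\<in>{1..2 * n}. mangoldt d :: real) \<le> real (Suc ?y) * (log 2 (2 * n) + 1) * ln (2 * n)"
        using sum_mangoldt_le[of "2 * n" ?y] elim by simp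
      also have "\<dots> \<le> (real n powr (1 - \<epsilon>) + 1) * (log 2 (2 * n) + 1) * ln (2 * n)"
        using elim by (intro mult_right_mono) auto
      finally have 1: "(\<Sum>d\<in>{1..2 * n}. mangoldt d :: real) \<le> (real n powr (1 - \<epsilon>) + 1) * (log 2 (2 * n) + 1) * ln (2 * n)" .
      have "real n * ln 4 - ln (2 * real n) = ln (4 ^ n / (2 * real n))"
        using elim by (simp add: ln_div ln_realpow)
      also have "\<dots> \<le> ln (real (2 * n choose n))"
        using central_binomial_lower_bound[of n] elim by (intro ln_mono) auto
      also have "\<dots> \<le> (\<Sum>d\<in>{1..2 * n}. mangoldt d)" by (rule ln_central_binomial_le)
      finally show False using 1 elim by simp
    qed
  qed
qed

section \<open>Closed walks modulo a prime\<close>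

lemma cong_in_range_eq:
  fixes a b p :: int
  assumes "0 \<le> a" "a < p" "0 \<le> b" "b < p" "p dvd a - b"
  shows "a = b"
proof -
  have "\<bar>a - b\<bar> < p" using assms by linarith
  then show ?thesis using assms(5) zdvd_imp_le[of p "\<bar>a - b\<bar>"] by (cases "a = b") auto
qed

text \<open>The vanishing of the moments of the weights \<open>e\<close> forces each fibre of \<open>b\<close> to have weight zero,
  by testing against the polynomial that vanishes at the other values.\<close>

lemma vandermonde_mod_prime:
  fixes e b :: "nat \<Rightarrow> int" and p :: int
  assumes p: "prime p" and b: "\<And>i. i < h \<Longrightarrow> 0 \<le> b i \<and> b i < p"
    and mom: "\<And>j. j < h \<Longrightarrow> p dvd (\<Sum>i<h. e i * b i ^ j)" and i: "i < h"
  shows "p dvd (\<Sum>k | k < h \<and> b k = b i. e k)"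
proof -
  define W where "W = b ` {..<h} - {b i}"
  define q where "q = (\<Prod>w\<in>W. [:- w, 1:])"
  have W: "finite W" unfolding W_def by simp
  have pq: "poly q x = (\<Prod>w\<in>W. x - w)" for x unfolding q_def by (simp add: poly_prod)
  \<comment> \<open>Leaving out the value \<open>b i\<close> keeps the degree of \<open>q\<close>
    below \<open>h\<close>, so only the given moments occur.\<close>
  have "card W < h"
  proof -
    have "card (b ` {..<h}) \<le> h" using card_image_le[of "{..<h}" b] by simp
    moreover have "card W < card (b ` {..<h})" unfolding W_def using i by (intro card_Diff1_less) auto
    ultimately show ?thesis by simp
  qed
  moreover have "degree q \<le> card W" unfolding q_def
    using degree_prod_sum_le[OF W, of "\<lambda>w. [:- w, 1:]"] by (simp add: o_def)
  ultimately have deg: "degree q < h" by simp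
  have "(\<Sum>k<h. e k * poly q (b k)) = (\<Sum>k<h. \<Sum>j\<le>degree q. coeff q j * (e k * b k ^ j))"
    by (simp add: poly_altdef sum_distrib_left mult_ac)
  also have "\<dots> = (\<Sum>j\<le>degree q. coeff q j * (\<Sum>k<h. e k * b k ^ j))"
    by (subst sum.swap) (simp add: sum_distrib_left)
  also have "p dvd \<dots>"
    by (rule dvd_sum, rule dvd_mult, rule mom) (use deg in auto)
  finally have 1: "p dvd (\<Sum>k<h. e k * poly q (b k))" .
  have "(\<Sum>k<h. e k * poly q (b k)) = (\<Sum>k | k < h \<and> b k = b i. e k * poly q (b k))"
  proof (rule sum.mono_neutral_right)
    show "\<forall>k\<in>{..<h} - {k. k < h \<and> b k = b i}. e k * poly q (b k) = 0"
    proof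
      fix k assume "k \<in> {..<h} - {k. k < h \<and> b k = b i}"
      then have "b k \<in> W" unfolding W_def by auto
      then have "poly q (b k) = 0" unfolding pq using W by (intro prod_zero) auto
      then show "e k * poly q (b k) = 0" by simp
    qed
  qed auto
  also have "\<dots> = (\<Sum>k | k < h \<and> b k = b i. e k) * poly q (b i)"
    unfolding sum_distrib_right by (rule sum.cong) auto
  finally have "p dvd (\<Sum>k | k < h \<and> b k = b i. e k) * poly q (b i)" using 1 by simp
  moreover have "\<not> p dvd poly q (b i)"
  proof
    assume "p dvd poly q (b i)"
    then obtain w where w: "w \<in> W" "p dvd b i - w"
      unfolding pq using p W by (auto simp: prime_dvd_prod_iff)
    then obtain k where "k < h" "w = b k" "b k \<noteq> b i" unfolding W_def by auto
    then show False using cong_in_range_eq[of "b i" p "b k"] b[OF i] b[of k] w(2) by auto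
  qed
  ultimately show ?thesis using p by (simp add: prime_dvd_mult_iff)
qed

text \<open>A cycle of length \<open>2 h\<close> in the voltage graph below projects to such a closed walk.\<close>

definition closed_walk :: "nat \<Rightarrow> nat \<Rightarrow> (nat \<Rightarrow> int \<Rightarrow> int \<Rightarrow> int) \<Rightarrow> nat \<Rightarrow> (nat \<Rightarrow> int) \<Rightarrow> (nat \<Rightarrow> int) \<Rightarrow> bool" where
  "closed_walk p d f h a b \<longleftrightarrow>
     (\<forall>i. a i \<in> {0..<int p} \<and> b i \<in> {0..<int p} \<and> a (Suc i) \<noteq> a i \<and> b (Suc i) \<noteq> b i
        \<and> a (i + h) = a i \<and> b (i + h) = b i) \<and>
     (\<forall>j<d. int p dvd (\<Sum>i<h. f j (a i) (b i) - f j (a (Suc i)) (b i)))"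

lemma telescope_cyclic:
  fixes a :: "nat \<Rightarrow> int"
  assumes "a h = a 0"
  shows "(\<Sum>i<h. a i - a (Suc i)) = 0"
  using sum_lessThan_telescope'[of a h] assms by simp

text \<open>The weights are the increments of \<open>a\<close>. Their moment of order 0 vanishes by
  telescoping round the walk, and the monomial \<open>x * y ^ j\<close> provides the moment of order
  \<open>j\<close>, so \<open>h - 1\<close> monomials are enough.\<close>

lemma closed_walk_vandermonde:
  assumes p: "prime p" and w: "closed_walk p d f h a b"
    and f: "\<And>j x y. j < h - 1 \<Longrightarrow> f j x y = x * y ^ Suc j" and d: "h - 1 \<le> d" and i: "i < h"
  shows "int p dvd (\<Sum>k | k < h \<and> b k = b i. a k - a (Suc k))"
proof (rule vandermonde_mod_prime[OF _ _ _ i])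
  show "prime (int p)" using p by simp
  show "0 \<le> b i \<and> b i < int p" for i using w by (auto simp: closed_walk_def)
  fix j assume j: "j < h"
  show "int p dvd (\<Sum>i<h. (a i - a (Suc i)) * b i ^ j)"
  proof (cases j)
    case 0
    have "a h = a 0" using w unfolding closed_walk_def by (metis add_0)
    then show ?thesis using 0 telescope_cyclic[of a h] by simp
  next
    case (Suc j')
    then have "int p dvd (\<Sum>i<h. f j' (a i) (b i) - f j' (a (Suc i)) (b i))"
      using w d j unfolding closed_walk_def by auto
    then show ?thesis using f[of j'] Suc j by (simp add: algebra_simps)
  qed
qed

text \<open>A value of \<open>b\<close> taken only once would have the single increment
  \<open>a i - a (Suc i)\<close> as its weight, and consecutive values of \<open>a\<close> differ
  modulo \<open>p\<close>.\<close>

lemma closed_walk_singleton: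
  assumes p: "prime p" and w: "closed_walk p d f h a b"
    and f: "\<And>j x y. j < h - 1 \<Longrightarrow> f j x y = x * y ^ Suc j" and d: "h - 1 \<le> d" and i: "i < h"
  shows "\<exists>k<h. k \<noteq> i \<and> b k = b i"
proof (rule ccontr)
  assume "\<not> ?thesis"
  then have "{k. k < h \<and> b k = b i} = {i}" using i by auto
  then have "int p dvd a i - a (Suc i)" using closed_walk_vandermonde[OF assms] by simp
  moreover have "0 \<le> a k" "a k < int p" for k using w by (auto simp: closed_walk_def)
  ultimately have "a i = a (Suc i)" using cong_in_range_eq by blast
  then show False using w unfolding closed_walk_def by metis
qed

lemma closed_walk_consecutive:
  assumes "closed_walk p d f h a b"
  shows "b (Suc i) \<noteq> b i" "b h = b 0" "a (Suc i) \<noteq> a i" "a h = a 0"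
  using assms unfolding closed_walk_def by (metis add_0)+

lemma less_numeral_cases:
  "k < (3::nat) \<longleftrightarrow> k = 0 \<or> k = 1 \<or> k = 2"
  "k < (4::nat) \<longleftrightarrow> k = 0 \<or> k = 1 \<or> k = 2 \<or> k = 3"
  "k < (5::nat) \<longleftrightarrow> k = 0 \<or> k = 1 \<or> k = 2 \<or> k = 3 \<or> k = 4"
  by auto

text \<open>Any two of three cyclic positions are neighbours, so no value of \<open>b\<close> can be
  repeated.\<close>

lemma no_closed_walk_3:
  assumes p: "prime p"
  shows "\<not> closed_walk p 2 (\<lambda>j x y. x * y ^ Suc j) 3 a b"
proof
  assume w: "closed_walk p 2 (\<lambda>j x y. x * y ^ Suc j) 3 a b"
  have "\<exists>k<3. k \<noteq> 0 \<and> b k = b 0" by (rule closed_walk_singleton[OF p w]) auto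
  then have "b 1 = b 0 \<or> b 2 = b 0" by (auto simp: less_numeral_cases)
  moreover have "b 1 \<noteq> b 0" using closed_walk_consecutive(1)[OF w, of 0] by simp
  moreover have "b 3 \<noteq> b 2" using closed_walk_consecutive(1)[OF w, of 2] by simp
  ultimately show False using closed_walk_consecutive(2)[OF w] by auto
qed

text \<open>If every value occurs at least twice among five positions, some value occurs three
  times, and three of five cyclic positions include two neighbours.\<close>

lemma no_closed_walk_5:
  assumes p: "prime p"
  shows "\<not> closed_walk p 4 (\<lambda>j x y. x * y ^ Suc j) 5 a b"
proof
  assume w: "closed_walk p 4 (\<lambda>j x y. x * y ^ Suc j) 5 a b"
  have s: "\<exists>k\<in>{0, 1, 2, 3, 4}. k \<noteq> i \<and> b k = b i" if "i < 5" for i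
  proof -
    have "\<exists>k<5. k \<noteq> i \<and> b k = b i"
      by (rule closed_walk_singleton[OF p w]) (use that in auto)
    then obtain k where "k < 5" "k \<noteq> i" "b k = b i" by blast
    moreover have "k \<in> {0, 1, 2, 3, 4}" using \<open>k < 5\<close> by auto
    ultimately show ?thesis by blast
  qed
  have n: "b 1 \<noteq> b 0" "b 2 \<noteq> b 1" "b 3 \<noteq> b 2" "b 4 \<noteq> b 3" "b 0 \<noteq> b 4"
    using closed_walk_consecutive(1)[OF w, of 0] closed_walk_consecutive(1)[OF w, of 1]
      closed_walk_consecutive(1)[OF w, of 2] closed_walk_consecutive(1)[OF w, of 3]
      closed_walk_consecutive(1)[OF w, of 4] closed_walk_consecutive(2)[OF w]
    by (simp_all add: numeral_eq_Suc)
  have "b 2 = b 0 \<or> b 3 = b 0" "b 3 = b 1 \<or> b 4 = b 1" "b 4 = b 2 \<or> b 0 = b 2" "b 0 = b 3 \<or> b 1 = b 3"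
    "b 1 = b 4 \<or> b 2 = b 4"
    using s[of 0] s[of 1] s[of 2] s[of 3] s[of 4] n by force+
  then show False using n by metis
qed

text \<open>With the monomials \<open>x y\<close>, \<open>x y\<^sup>2\<close>, \<open>x y\<^sup>3\<close> a closed walk of length 8 has \<open>b\<close>-coordinates \<open>b 0, b 1, b 0, b 1\<close>
  and \<open>a 0 + a 2 = a 1 + a 3\<close>; the monomial \<open>x\<^sup>2 y\<close> adds the same relation for the squares.\<close>

definition mon8 :: "nat \<Rightarrow> int \<Rightarrow> int \<Rightarrow> int" where
  "mon8 j x y = (if j < 3 then x * y ^ Suc j else x\<^sup>2 * y)"

lemma no_closed_walk_4:
  assumes p: "prime p" and p2: "p > 2"
  shows "\<not> closed_walk p 4 mon8 4 a b"
proof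
  assume w: "closed_walk p 4 mon8 4 a b"
  have f: "\<And>j x y. j < 4 - 1 \<Longrightarrow> mon8 j x y = x * y ^ Suc j" by (simp add: mon8_def)
  have s: "\<exists>k<4. k \<noteq> i \<and> b k = b i" if "i < 4" for i
    by (rule closed_walk_singleton[OF p w f]) (use that in auto)
  have n: "b 1 \<noteq> b 0" "b 2 \<noteq> b 1" "b 3 \<noteq> b 2" "b 0 \<noteq> b 3" "a 1 \<noteq> a 0" "a 0 \<noteq> a 3" "a 4 = a 0"
    using closed_walk_consecutive(1)[OF w, of 0] closed_walk_consecutive(1)[OF w, of 1]
      closed_walk_consecutive(1)[OF w, of 2] closed_walk_consecutive(1)[OF w, of 3]
      closed_walk_consecutive(3)[OF w, of 0] closed_walk_consecutive(3)[OF w, of 3]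
      closed_walk_consecutive(2,4)[OF w]
    by (simp_all add: numeral_eq_Suc)
  have b: "b 2 = b 0" "b 3 = b 1"
    using s[of 0] s[of 1] n by (auto simp: less_numeral_cases)
  have "{k. k < 4 \<and> b k = b 0} = {0, 2}" using n b by (auto simp: less_numeral_cases)
  moreover have "int p dvd (\<Sum>k | k < 4 \<and> b k = b 0. a k - a (Suc k))"
    by (rule closed_walk_vandermonde[OF p w f]) auto
  ultimately have d1: "int p dvd a 0 - a 1 + (a 2 - a 3)" by (simp add: numeral_eq_Suc)
  have "int p dvd (\<Sum>i<4. mon8 3 (a i) (b i) - mon8 3 (a (Suc i)) (b i))"
    using w unfolding closed_walk_def by auto
  moreover have "(\<Sum>i<4. mon8 3 (a i) (b i) - mon8 3 (a (Suc i)) (b i))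
     = (b 0 - b 1) * ((a 0)\<^sup>2 - (a 1)\<^sup>2 + (a 2)\<^sup>2 - (a 3)\<^sup>2)"
  proof -
    have "(\<Sum>i<4. mon8 3 (a i) (b i) - mon8 3 (a (Suc i)) (b i)) = ((a 0)\<^sup>2 - (a 1)\<^sup>2) * b 0
       + ((a 1)\<^sup>2 - (a 2)\<^sup>2) * b 1 + ((a 2)\<^sup>2 - (a 3)\<^sup>2) * b 2 + ((a 3)\<^sup>2 - (a 4)\<^sup>2) * b 3"
      by (simp add: eval_nat_numeral mon8_def algebra_simps)
    then show ?thesis unfolding b n(7) by (simp add: algebra_simps)
  qed
  ultimately have d2: "int p dvd (b 0 - b 1) * ((a 0)\<^sup>2 - (a 1)\<^sup>2 + (a 2)\<^sup>2 - (a 3)\<^sup>2)" by simp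
  have pp: "prime (int p)" using p by simp
  have ar: "0 \<le> a k" "a k < int p" "0 \<le> b k" "b k < int p" for k using w by (auto simp: closed_walk_def)
  have "\<not> int p dvd b 0 - b 1" using cong_in_range_eq[OF ar(3)[of 0] ar(4)[of 0] ar(3)[of 1] ar(4)[of 1]] n(1) by auto
  then have d3: "int p dvd (a 0)\<^sup>2 - (a 1)\<^sup>2 + (a 2)\<^sup>2 - (a 3)\<^sup>2" using d2 pp by (simp add: prime_dvd_mult_iff)
  \<comment> \<open>Two pairs with equal sums and equal sums of squares coincide modulo an odd
    prime, so \<open>a 0\<close> would equal \<open>a 1\<close> or \<open>a 3\<close>. The identity
    expresses this; the factor 2 is why \<open>p > 2\<close> is assumed.\<close>
  have "2 * ((a 0 - a 1) * (a 0 - a 3)) = ((a 0)\<^sup>2 - (a 1)\<^sup>2 + (a 2)\<^sup>2 - (a 3)\<^sup>2)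
     + (a 0 - a 1 + (a 2 - a 3)) * (a 0 - a 1 - (a 2 + a 3))"
    by (simp add: power2_eq_square algebra_simps)
  then have "int p dvd 2 * ((a 0 - a 1) * (a 0 - a 3))" using d1 d3 by simp
  moreover have "\<not> int p dvd 2" using p2 zdvd_imp_le[of "int p" 2] by auto
  moreover have "\<not> int p dvd a 0 - a 1" using cong_in_range_eq[OF ar(1)[of 0] ar(2)[of 0] ar(1)[of 1] ar(2)[of 1]] n by auto
  moreover have "\<not> int p dvd a 0 - a 3" using cong_in_range_eq[OF ar(1)[of 0] ar(2)[of 0] ar(1)[of 3] ar(2)[of 3]] n by auto
  ultimately show False using pp by (simp add: prime_dvd_mult_iff)
qed

section \<open>Voltage graphs\<close>

lemma inj_on_map_prod:
  assumes \<phi>: "inj_on \<phi> V" and M: "M \<subseteq> V \<times> V"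
  shows "inj_on fst M \<Longrightarrow> inj_on fst (map_prod \<phi> \<phi> ` M)"
    and "inj_on snd M \<Longrightarrow> inj_on snd (map_prod \<phi> \<phi> ` M)"
proof -
  assume i: "inj_on fst M"
  have "inj_on (\<phi> \<circ> fst) M"
    using i M by (intro comp_inj_on inj_on_subset[OF \<phi>]) auto
  then have "inj_on (fst \<circ> map_prod \<phi> \<phi>) M" by (simp add: inj_on_def)
  then show "inj_on fst (map_prod \<phi> \<phi> ` M)" by (rule inj_on_imageI)
next
  assume i: "inj_on snd M"
  have "inj_on (\<phi> \<circ> snd) M"
    using i M by (intro comp_inj_on inj_on_subset[OF \<phi>]) auto
  then have "inj_on (snd \<circ> map_prod \<phi> \<phi>) M" by (simp add: inj_on_def)
  then show "inj_on snd (map_prod \<phi> \<phi> ` M)" by (rule inj_on_imageI)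
qed

type_synonym vertex = "nat \<times> nat \<times> nat \<times> (nat \<Rightarrow> int)"

text \<open>Disjoint copies of the bipartite graph in which the point \<open>(a, x)\<close> and the line \<open>(b, y)\<close> are
  adjacent if \<open>x j + y j = f j a b\<close> modulo \<open>p\<close> for all \<open>j < d\<close>. In a vertex \<open>(c, l, i, x)\<close>, \<open>c\<close> is the
  number of the copy and \<open>l\<close> that of the layer; points form the even layers, lines the odd ones, and
  \<open>l div 2 * t + i\<close> is the first coordinate.\<close>

locale voltage_graph =
  fixes p d s t r :: nat and f :: "nat \<Rightarrow> int \<Rightarrow> int \<Rightarrow> int"
  assumes p_pos: "p > 0" and s_pos: "s > 0" and t_pos: "t > 0" and st: "s * t \<le> p"
begin

definition vecs :: "(nat \<Rightarrow> int) set" where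
  "vecs = (\<Pi>\<^sub>E j\<in>{..<d}. {0..<int p})"

definition verts :: "vertex set" where
  "verts = {..<r} \<times> {..<2 * s} \<times> {..<t} \<times> vecs"

fun layer :: "vertex \<Rightarrow> nat" where "layer (c, l, i, x) = l"
fun coord :: "vertex \<Rightarrow> int" where "coord (c, l, i, x) = int (l div 2 * t + i)"
fun vec :: "vertex \<Rightarrow> nat \<Rightarrow> int" where "vec (c, l, i, x) = x"

definition adj :: "vertex \<Rightarrow> vertex \<Rightarrow> bool" where
  "adj u v \<longleftrightarrow> u \<in> verts \<and> v \<in> verts \<and> fst u = fst v \<and> even (layer u) \<and> odd (layer v) \<and>
     (\<forall>j<d. int p dvd vec u j + vec v j - f j (coord u) (coord v))"

lemma card_vecs: "finite vecs" "card vecs = p ^ d"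
  unfolding vecs_def by (simp_all add: finite_PiE card_PiE)

lemma finite_verts: "finite verts"
  unfolding verts_def using card_vecs by simp

lemma card_verts: "card verts = r * (2 * s * (t * p ^ d))"
  unfolding verts_def by (simp add: card_cartesian_product card_vecs)

text \<open>The point layer \<open>2 * m\<close> and the line layer \<open>2 * m + 1\<close> share
  the block of \<open>t\<close> residues starting at \<open>m * t\<close>; the \<open>s\<close>
  blocks fit because of \<open>s * t \<le> p\<close>.\<close>

lemma coord_range: "v \<in> verts \<Longrightarrow> coord v \<in> {0..<int p}"
proof -
  assume v: "v \<in> verts"
  obtain c l i x where cl: "v = (c, l, i, x)" by (metis prod_cases4)
  then have l: "l div 2 < s" "i < t" using v by (auto simp: verts_def)
  then have "Suc (l div 2) * t \<le> s * t" by (intro mult_right_mono) auto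
  then have "l div 2 * t + i < p" using l st by simp
  then show ?thesis unfolding cl by (simp del: of_nat_add of_nat_mult)
qed

lemma vec_range: "v \<in> verts \<Longrightarrow> j < d \<Longrightarrow> vec v j \<in> {0..<int p}"
  by (cases v rule: vec.cases) (auto simp: verts_def vecs_def PiE_def Pi_def)

text \<open>Division by \<open>t\<close> recovers block and index from the first coordinate, and the
  parity then gives the layer.\<close>

lemma vertex_eqI:
  assumes "u \<in> verts" "v \<in> verts" "fst u = fst v" "even (layer u) \<longleftrightarrow> even (layer v)" "coord u = coord v"
    "\<And>j. j < d \<Longrightarrow> int p dvd vec u j - vec v j"
  shows "u = v"
proof -
  obtain c l i x where u: "u = (c, l, i, x)" by (metis prod_cases4)
  obtain c' l' i' x' where v: "v = (c', l', i', x')" by (metis prod_cases4)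
  have i: "i < t" "i' < t" using assms(1,2) by (auto simp: u v verts_def)
  have "l div 2 * t + i = l' div 2 * t + i'" using assms(5) unfolding u v coord.simps by (simp only: of_nat_eq_iff)
  then have "(l div 2 * t + i) div t = (l' div 2 * t + i') div t" "(l div 2 * t + i) mod t = (l' div 2 * t + i') mod t"
    by simp_all
  then have "l div 2 = l' div 2" "i = i'" using i by simp_all
  moreover have "l mod 2 = l' mod 2" using assms(4) by (auto simp: u v even_iff_mod_2_eq_zero odd_iff_mod_2_eq_one)
  ultimately have "l = l'" by (metis div_mult_mod_eq)
  moreover have "x = x'"
  proof (rule PiE_ext)
    show "x \<in> (\<Pi>\<^sub>E j\<in>{..<d}. {0..<int p})" "x' \<in> (\<Pi>\<^sub>E j\<in>{..<d}. {0..<int p})"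
      using assms(1,2) by (auto simp: u v verts_def vecs_def)
    fix j assume "j \<in> {..<d}"
    then show "x j = x' j"
      using cong_in_range_eq[of "x j" p "x' j"] assms(6)[of j] vec_range[OF assms(1), of j] vec_range[OF assms(2), of j]
      by (simp add: u v)
  qed
  ultimately show ?thesis using assms(3) \<open>i = i'\<close> by (simp add: u v)
qed

text \<open>The adjacency equations determine the vector of a neighbour of \<open>w\<close> from its
  first coordinate. Hence cycles project to walks without repetition of consecutive
  coordinates.\<close>

lemma adj_coord_inj:
  assumes "adj u w" "adj v w" "coord u = coord v"
  shows "u = v"
proof (rule vertex_eqI)
  fix j assume "j < d"
  then have "int p dvd (vec u j + vec w j - f j (coord u) (coord w)) - (vec v j + vec w j - f j (coord v) (coord w))"
    using assms unfolding adj_def by - (rule dvd_diff, auto)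
  then show "int p dvd vec u j - vec v j" using assms(3) by simp
qed (use assms in \<open>auto simp: adj_def\<close>)

lemma adj_coord_inj':
  assumes "adj w u" "adj w v" "coord u = coord v"
  shows "u = v"
proof (rule vertex_eqI)
  fix j assume "j < d"
  then have "int p dvd (vec w j + vec u j - f j (coord w) (coord u)) - (vec w j + vec v j - f j (coord w) (coord v))"
    using assms unfolding adj_def by - (rule dvd_diff, auto)
  then show "int p dvd vec u j - vec v j" using assms(3) by simp
qed (use assms in \<open>auto simp: adj_def\<close>)

text \<open>The layer prescribes a block of \<open>t\<close> first coordinates, and each of them
  belongs to exactly one neighbour of \<open>w\<close>.\<close>

lemma card_neighbours_in_layer:
  assumes w: "w \<in> verts" and l': "l' < 2 * s" "even l' \<longleftrightarrow> odd (layer w)"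
  shows "card {v. layer v = l' \<and> (adj w v \<or> adj v w)} = t"
proof -
  obtain c l i x where u: "w = (c, l, i, x)" by (metis prod_cases4)
  \<comment> \<open>\<open>f\<close> takes the point before the line, so the order of its arguments
    depends on which of the two \<open>w\<close> is.\<close>
  define g where "g i' j = (let b = int (l' div 2 * t + i') in
     if even l then f j (coord w) b else f j b (coord w))" for i' j
  define nb where "nb i' = (c, l', i', \<lambda>j\<in>{..<d}. (g i' j - x j) mod int p)" for i'
  have nb_verts: "nb i' \<in> verts" if "i' < t" for i'
    using w that l' p_pos by (auto simp: u nb_def verts_def vecs_def)
  have nb_adj: "adj w (nb i') \<or> adj (nb i') w" if "i' < t" for i'
  proof -
    have 1: "int p dvd x j + (g i' j - x j) mod int p - g i' j" for j
      by (simp add: mod_eq_dvd_iff[symmetric] mod_simps)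
    have 2: "int p dvd (g i' j - x j) mod int p + x j - g i' j" for j
      using 1[of j] by (simp add: add.commute)
    show ?thesis
    proof (cases "even l")
      case True
      then have "adj w (nb i')"
        using w nb_verts[OF that] l' 1 unfolding adj_def by (auto simp: u nb_def g_def)
      then show ?thesis ..
    next
      case False
      then have "adj (nb i') w"
        using w nb_verts[OF that] l' 2 unfolding adj_def by (auto simp: u nb_def g_def)
      then show ?thesis ..
    qed
  qed
  have "{v. layer v = l' \<and> (adj w v \<or> adj v w)} = nb ` {..<t}"
  proof (intro equalityI subsetI)
    fix v assume v: "v \<in> {v. layer v = l' \<and> (adj w v \<or> adj v w)}"
    obtain c' m i' y where vv: "v = (c', m, i', y)" by (metis prod_cases4)
    have i': "i' < t" using v by (auto simp: vv adj_def verts_def)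
    have m: "m = l'" using v by (simp add: vv)
    have co: "coord v = coord (nb i')" using m by (simp add: vv nb_def)
    have "v = nb i'"
    proof (cases "adj w v")
      case True
      moreover have "\<not> adj (nb i') w" using True l' unfolding adj_def by (auto simp: nb_def)
      ultimately show ?thesis using nb_adj[OF i'] co adj_coord_inj' by blast
    next
      case False
      then have "adj v w" using v by simp
      moreover from this have "\<not> adj w (nb i')" using l' unfolding adj_def by (auto simp: nb_def)
      ultimately show ?thesis using nb_adj[OF i'] co adj_coord_inj by blast
    qed
    then show "v \<in> nb ` {..<t}" using i' by simp
  next
    fix v assume "v \<in> nb ` {..<t}"
    then obtain i' where i': "i' < t" "v = nb i'" by auto
    then show "v \<in> {v. layer v = l' \<and> (adj w v \<or> adj v w)}" using nb_adj[OF i'(1)] by (auto simp: nb_def)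
  qed
  moreover have "inj_on nb {..<t}" by (auto simp: inj_on_def nb_def)
  ultimately show ?thesis by (simp add: card_image)
qed

section \<open>The layered bipartite graph\<close>

definition steps :: "(vertex \<times> vertex) set" where
  "steps = {(u, v). layer v = Suc (layer u) \<and> (adj u v \<or> adj v u)}"

definition sources :: "vertex set" where "sources = {u \<in> verts. layer u < 2 * s - 1}"
definition targets :: "vertex set" where "targets = {v \<in> verts. layer v > 0}"

lemma card_sources: "card sources = r * ((2 * s - 1) * (t * p ^ d))"
proof -
  have "sources = {..<r} \<times> {..<2 * s - 1} \<times> {..<t} \<times> vecs"
    by (auto simp: sources_def verts_def)
  then show ?thesis by (simp add: card_cartesian_product card_vecs)
qed

lemma layer_less: "v \<in> verts \<Longrightarrow> layer v < 2 * s"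
  by (auto simp: verts_def)

text \<open>The two sides are tails and heads, not points and lines: a vertex of an inner layer
  occurs on both. A matching is thus a set of directed edges with in-degree and out-degree at most
  1.\<close>

lemma biregular_steps: "biregular steps sources targets t"
proof
  show "finite sources" "finite targets" using finite_verts by (auto simp: sources_def targets_def)
  show "steps \<subseteq> sources \<times> targets"
    using layer_less by (fastforce simp: steps_def sources_def targets_def adj_def)
  show "t > 0" by (rule t_pos)
  show "card {y. (x, y) \<in> steps} = t" if "x \<in> sources" for x
  proof -
    have "{y. (x, y) \<in> steps} = {v. layer v = Suc (layer x) \<and> (adj x v \<or> adj v x)}"
      by (auto simp: steps_def)
    moreover have "x \<in> verts" "Suc (layer x) < 2 * s" using that by (auto simp: sources_def)
    ultimately show ?thesis using card_neighbours_in_layer[of x "Suc (layer x)"] by simp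
  qed
  show "card {x. (x, y) \<in> steps} = t" if "y \<in> targets" for y
  proof -
    have "layer y > 0" "layer y < 2 * s" using that layer_less by (auto simp: targets_def)
    moreover have "{x. (x, y) \<in> steps} = {v. layer v = layer y - 1 \<and> (adj y v \<or> adj v y)}"
      using \<open>layer y > 0\<close> by (auto simp: steps_def)
    ultimately show ?thesis using card_neighbours_in_layer[of y "layer y - 1"] that by (simp add: targets_def)
  qed
qed

section \<open>Cycles and creating families in the embedded graph\<close>

definition edges :: "(vertex \<Rightarrow> nat) \<Rightarrow> nat set set" where
  "edges \<phi> = {{\<phi> u, \<phi> v} | u v. adj u v}"

lemma edgesI: "adj u v \<Longrightarrow> {\<phi> u, \<phi> v} \<in> edges \<phi>"
  unfolding edges_def by blast

text \<open>Points \<open>P i\<close> and lines \<open>Q i\<close> alternate on the cycle. Going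
  round, the vectors cancel and only the sum of the increments of \<open>f\<close> remains. Vertices
  two steps apart differ because \<open>h \<ge> 2\<close>, so their coordinates differ too.\<close>

lemma cycle_imp_closed_walk:
  assumes phi: "inj_on \<phi> verts" and cyc: "contains_cycle (edges \<phi>) (2 * h)" and h: "h \<ge> 2"
  shows "\<exists>a b. closed_walk p d f h a b"
proof -
  obtain vs where vs: "length vs = 2 * h" "distinct vs"
    "\<And>i. i < 2 * h \<Longrightarrow> {vs ! i, vs ! ((Suc i) mod (2 * h))} \<in> edges \<phi>"
    using cyc unfolding contains_cycle_def by auto
  define q where "q k = inv_into verts \<phi> (vs ! (k mod (2 * h)))" for k
  have q_adj: "adj (q k) (q (Suc k)) \<or> adj (q (Suc k)) (q k)" for k
  proof -
    have "k mod (2 * h) < 2 * h" using h by simp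
    from vs(3)[OF this] obtain u v where uv: "adj u v"
      "{vs ! (k mod (2 * h)), vs ! (Suc k mod (2 * h))} = {\<phi> u, \<phi> v}"
      unfolding edges_def by (auto simp: mod_Suc_eq)
    have "inv_into verts \<phi> (\<phi> u) = u" "inv_into verts \<phi> (\<phi> v) = v"
      using uv(1) phi by (auto simp: adj_def)
    then show ?thesis using uv unfolding q_def by (auto simp: doubleton_eq_iff)
  qed
  have q_verts: "q k \<in> verts" for k using q_adj[of k] by (auto simp: adj_def)
  have phi_q: "\<phi> (q k) = vs ! (k mod (2 * h))" for k
  proof -
    have kl: "k mod (2 * h) < 2 * h" using h by simp
    from vs(3)[OF kl] obtain u v where "adj u v" "{vs ! (k mod (2 * h)), vs ! (Suc k mod (2 * h))} = {\<phi> u, \<phi> v}"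
      unfolding edges_def by (auto simp: mod_Suc_eq)
    then have "vs ! (k mod (2 * h)) \<in> \<phi> ` verts" by (auto simp: adj_def doubleton_eq_iff)
    then show ?thesis unfolding q_def by (rule f_inv_into_f)
  qed
  have q_neq: "q k \<noteq> q (k + 2)" for k
  proof
    assume "q k = q (k + 2)"
    then have "vs ! (k mod (2 * h)) = vs ! ((k + 2) mod (2 * h))" using phi_q by metis
    then have "k mod (2 * h) = (k + 2) mod (2 * h)" using vs(1,2) h by (simp add: nth_eq_iff_index_eq)
    then have "2 * h dvd 2" using mod_eq_dvd_iff_nat[of k "k + 2" "2 * h"] by simp
    then show False using h dvd_imp_le[of "2 * h" 2] by simp
  qed
  have q_per: "q (k + 2 * h) = q k" for k unfolding q_def by simp
  have par: "even (layer (q (Suc k))) \<longleftrightarrow> odd (layer (q k))" for k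
    using q_adj[of k] by (auto simp: adj_def)
  \<comment> \<open>A shift by at most one makes the cycle start at a point.\<close>
  obtain o' where o': "even (layer (q o'))" using par[of 0] by (cases "even (layer (q 0))") auto
  have ev: "even (layer (q (o' + k))) \<longleftrightarrow> even k" for k
    by (induction k) (use o' par in auto)
  define P where "P i = q (o' + 2 * i)" for i
  define Q where "Q i = q (Suc (o' + 2 * i))" for i
  have PQ: "adj (P i) (Q i)" for i
    using q_adj[of "o' + 2 * i"] ev[of "2 * i"] unfolding P_def Q_def by (auto simp: adj_def)
  have PQ': "adj (P (Suc i)) (Q i)" for i
    using q_adj[of "Suc (o' + 2 * i)"] ev[of "Suc (2 * i)"] unfolding P_def Q_def by (auto simp: adj_def)
  have neq: "P (Suc i) \<noteq> P i" "Q (Suc i) \<noteq> Q i" for i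
    using q_neq[of "o' + 2 * i"] q_neq[of "Suc (o' + 2 * i)"] unfolding P_def Q_def by auto
  have per: "P (i + h) = P i" "Q (i + h) = Q i" for i
    using q_per[of "o' + 2 * i"] q_per[of "Suc (o' + 2 * i)"] unfolding P_def Q_def by (auto simp: algebra_simps)
  have "closed_walk p d f h (\<lambda>i. coord (P i)) (\<lambda>i. coord (Q i))"
    unfolding closed_walk_def
  proof (intro conjI allI impI)
    fix i
    show "coord (P i) \<in> {0..<int p}" "coord (Q i) \<in> {0..<int p}"
      using coord_range q_verts unfolding P_def Q_def by auto
    show "coord (P (Suc i)) \<noteq> coord (P i)" using adj_coord_inj[OF PQ' PQ] neq(1) by blast
    show "coord (Q (Suc i)) \<noteq> coord (Q i)" using adj_coord_inj'[OF PQ PQ'] neq(2) by blast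
    show "coord (P (i + h)) = coord (P i)" "coord (Q (i + h)) = coord (Q i)" using per by auto
  next
    fix j assume j: "j < d"
    let ?x = "\<lambda>i. vec (P i) j"
    \<comment> \<open>Subtracting the equations of the two edges at \<open>Q i\<close> eliminates
      the vector of the line.\<close>
    have "int p dvd (\<Sum>i<h. (?x i - ?x (Suc i)) - (f j (coord (P i)) (coord (Q i)) - f j (coord (P (Suc i))) (coord (Q i))))"
    proof (rule dvd_sum)
      fix i
      have "int p dvd (?x i + vec (Q i) j - f j (coord (P i)) (coord (Q i)))
         - (?x (Suc i) + vec (Q i) j - f j (coord (P (Suc i))) (coord (Q i)))"
        using PQ[of i] PQ'[of i] j unfolding adj_def by - (rule dvd_diff, auto)
      then show "int p dvd (?x i - ?x (Suc i)) - (f j (coord (P i)) (coord (Q i)) - f j (coord (P (Suc i))) (coord (Q i)))"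
        by (simp add: algebra_simps)
    qed
    moreover have "(\<Sum>i<h. ?x i - ?x (Suc i)) = 0" using per(1)[of 0] by (intro telescope_cyclic) simp
    ultimately show "int p dvd (\<Sum>i<h. f j (coord (P i)) (coord (Q i)) - f j (coord (P (Suc i))) (coord (Q i)))"
      by (simp add: sum_subtractf[of "\<lambda>i. ?x i - ?x (Suc i)"] dvd_diff_commute)
  qed
  then show ?thesis by blast
qed

text \<open>The orderings with at most \<open>n - k\<close> edges outside the embedded graph are
  numerous by the count of matchings, and averaging turns this into a bound for \<open>F\<close>;
  their number \<open>card J\<close> cancels.\<close>

lemma creating_bound:
  assumes no_walk: "\<And>a b. \<not> closed_walk p d f h a b" and h: "h \<ge> 2"
    and n: "card verts \<le> n" and r: "r > 0"
    and eps: "0 < \<epsilon>" "\<epsilon> \<le> 1" and k: "real k \<le> (1 - \<epsilon>) * real (card sources)"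
    and L: "real L \<ge> 4 / \<epsilon>" and t: "real t \<ge> 4 * (real L)\<^sup>2 / \<epsilon>"
    and F: "F \<subseteq> ham_paths n" "creating (2 * h) F"
  shows "real (card F) * (real t * \<epsilon> / (2 * real L)) ^ k \<le> fact n * (real n ^ 2 + 1) ^ (3 ^ (2 * h) * (n - k)) * 2 ^ n"
proof -
  interpret B: biregular steps sources targets t
    by (rule biregular_steps)
  obtain \<phi> where phi: "inj_on \<phi> verts" "\<phi> ` verts \<subseteq> {0..<n}"
  proof -
    have "card verts \<le> card {0..<n}" using n by simp
    then show ?thesis using card_le_inj[of verts "{0..<n}"] finite_verts that by auto
  qed
  let ?G = "edges \<phi>"
  have G: "\<not> contains_cycle ?G (2 * h)" using cycle_imp_closed_walk[OF phi(1) _ h] no_walk by blast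
  let ?S = "(`) (map_prod \<phi> \<phi>) ` B.matchings k"
  let ?J = "{zs \<in> orderings n. card (path_edges zs - ?G) \<le> n - k}"
  let ?K = "(n\<^sup>2 + 1) ^ (3 ^ (2 * h) * (n - k))"
  have sv: "steps \<subseteq> verts \<times> verts" unfolding steps_def adj_def by auto
  have mv: "M \<subseteq> verts \<times> verts" if "M \<in> B.matchings k" for M
    using that sv unfolding B.matchings_def matching_def by auto
  have inj2: "inj_on (map_prod \<phi> \<phi>) (verts \<times> verts)" using phi(1) by (intro map_prod_inj_on)
  have cS: "card ?S = card (B.matchings k)"
  proof (rule card_image)
    show "inj_on ((`) (map_prod \<phi> \<phi>)) (B.matchings k)"
      using inj_on_image[of "map_prod \<phi> \<phi>" "B.matchings k"] inj2 mv by (meson Sup_least inj_on_subset)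
  qed
  \<comment> \<open>Matching edges lead to the next layer, so the layer is the rank that makes the
    image of a matching a linear forest.\<close>
  have "card ?S \<le> card ?J * 2 ^ n"
  proof (rule card_linear_forests_le[where rk = "\<lambda>m. layer (inv_into verts \<phi> m)"])
    fix S assume "S \<in> ?S"
    then obtain M where M: "M \<in> B.matchings k" "S = map_prod \<phi> \<phi> ` M" by auto
    have mM: "M \<subseteq> steps" "inj_on fst M" "inj_on snd M" "card M = k"
      using M(1) unfolding B.matchings_def matching_def by auto
    have "S \<subseteq> {0..<n} \<times> {0..<n}" using M(2) mv[OF M(1)] phi(2) by fastforce
    moreover have "inj_on fst S" "inj_on snd S"
      unfolding M(2) using inj_on_map_prod[OF phi(1) mv[OF M(1)]] mM by auto
    moreover have "card S = k"
      using M(2) mM(4) card_image[OF inj_on_subset[OF inj2 mv[OF M(1)]]] by simp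
    moreover have "\<forall>(u, v)\<in>S. layer (inv_into verts \<phi> u) < layer (inv_into verts \<phi> v) \<and> {u, v} \<in> ?G"
    proof clarify
      fix u v assume "(u, v) \<in> S"
      then obtain u' v' where h: "(u', v') \<in> M" "u = \<phi> u'" "v = \<phi> v'" using M(2) by auto
      have uv: "u' \<in> verts" "v' \<in> verts" "(u', v') \<in> steps" using h(1) mv[OF M(1)] mM(1) by auto
      have "inv_into verts \<phi> u = u'" "inv_into verts \<phi> v = v'" using h uv phi(1) by auto
      moreover have "{u, v} \<in> ?G" using uv(3) edgesI[of u' v'] edgesI[of v' u'] unfolding h(2,3) steps_def by (auto simp: insert_commute)
      ultimately show "layer (inv_into verts \<phi> u) < layer (inv_into verts \<phi> v) \<and> {u, v} \<in> ?G"
        using uv(3) by (simp add: steps_def)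
    qed
    ultimately show "S \<subseteq> {0..<n} \<times> {0..<n} \<and> inj_on fst S \<and> inj_on snd S \<and> card S = k \<and>
      (\<forall>(u, v)\<in>S. layer (inv_into verts \<phi> u) < layer (inv_into verts \<phi> v) \<and> {u, v} \<in> ?G)" by blast
  qed
  then have "real (card ?S) \<le> real (card ?J * 2 ^ n)" by (simp only: of_nat_le_iff)
  then have 1: "real (card (B.matchings k)) \<le> real (card ?J) * 2 ^ n"
    unfolding cS by simp
  have "card F * card ?J \<le> fact n * ?K"
  proof (rule card_creating_mult_le[OF F])
    fix F' assume "F' \<subseteq> path_edges ` ?J" "creating (2 * h) F'"
    then show "card F' \<le> ?K" using h by (intro card_creating_few_bad_edges[OF G]) auto
  qed auto
  then have "real (card F * card ?J) \<le> real (fact n * ?K)" by (simp only: of_nat_le_iff)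
  then have 2: "real (card F) * real (card ?J) \<le> fact n * (real n ^ 2 + 1) ^ (3 ^ (2 * h) * (n - k))"
    by (simp add: add.commute)
  have "sources \<noteq> {}"
  proof -
    have "card sources > 0" unfolding card_sources using r s_pos t_pos p_pos by simp
    then show ?thesis by auto
  qed
  then have "(real t * \<epsilon> / (2 * real L)) ^ k \<le> real (card (B.matchings k))"
    by (intro B.card_matchings_ge eps k L t)
  then have "real (card F) * (real t * \<epsilon> / (2 * real L)) ^ k \<le> real (card F) * (real (card ?J) * 2 ^ n)"
    using 1 by (intro mult_left_mono) auto
  also have "\<dots> \<le> fact n * (real n ^ 2 + 1) ^ (3 ^ (2 * h) * (n - k)) * 2 ^ n"
    using 2 mult_right_mono[OF 2, of "2 ^ n"] by (simp add: mult_ac)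
  finally show ?thesis .
qed

end

section \<open>Asymptotics\<close>

text \<open>\<open>2 * p ^ q\<close> will bound the size of one copy of the graph. One factor
  \<open>1 - \<epsilon>\<close> in the exponent pays for the prime interval, a second one for the
  constants, and their product is at least \<open>1 - 2 * \<epsilon>\<close>.\<close>

lemma eventually_prime_power_le:
  assumes eps: "0 < \<epsilon>" "\<epsilon> < 1" and q: "q > 0"
  shows "\<forall>\<^sub>F n in at_top. \<exists>p. prime p \<and> p > 2 \<and> 2 * real p ^ q \<le> \<epsilon> * real n
    \<and> real n powr ((1 - 2 * \<epsilon>) / real q) \<le> real p"
proof -
  define c where "c = 1 / real q"
  have c: "c > 0" using q by (simp add: c_def)
  \<comment> \<open>Halved because the prime found may be as large as
    \<open>2 * m n\<close>.\<close>
  define x where "x n = (\<epsilon> * real n / 2) powr c / 2" for n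
  define m where "m n = nat \<lfloor>x n\<rfloor>" for n
  have "filterlim x at_top at_top" unfolding x_def using c eps by real_asymp
  then have "filterlim m at_top at_top" unfolding m_def
    by (intro filterlim_compose[OF filterlim_nat_sequentially] filterlim_compose[OF filterlim_floor_sequentially])
  then have ev1: "\<forall>\<^sub>F n in at_top. \<exists>p. prime p \<and> real (m n) powr (1 - \<epsilon>) \<le> real p \<and> p \<le> 2 * m n"
    by (rule eventually_compose_filterlim[OF eventually_prime_between[OF eps]])
  have "(1 - \<epsilon>) * c < c" using c eps by simp
  then have ev2: "\<forall>\<^sub>F n in at_top. real n powr ((1 - \<epsilon>) * c) \<le> x n - 1"
    unfolding x_def using c eps by real_asymp
  have "(1 - \<epsilon>) * ((1 - \<epsilon>) * c) > 0" using c eps by simp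
  then have ev3: "\<forall>\<^sub>F n in at_top. real n powr ((1 - \<epsilon>) * ((1 - \<epsilon>) * c)) > 2"
    by real_asymp
  show ?thesis using ev1 ev2 ev3 eventually_ge_at_top[of 1]
  proof eventually_elim
    case (elim n)
    then obtain p where p: "prime p" "real (m n) powr (1 - \<epsilon>) \<le> real p" "p \<le> 2 * m n" by auto
    have x0: "x n \<ge> 0" by (simp add: x_def)
    have mx: "real (m n) \<le> x n" "x n - 1 \<le> real (m n)" using x0 unfolding m_def by linarith+
    have "real n powr ((1 - \<epsilon>) * ((1 - \<epsilon>) * c)) = (real n powr ((1 - \<epsilon>) * c)) powr (1 - \<epsilon>)"
      by (simp add: powr_powr mult_ac)
    also have "\<dots> \<le> real (m n) powr (1 - \<epsilon>)"
      using elim(2) mx eps by (intro powr_mono2) auto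
    also have "\<dots> \<le> real p" by (rule p(2))
    finally have pn: "real n powr ((1 - \<epsilon>) * ((1 - \<epsilon>) * c)) \<le> real p" .
    have "real n powr ((1 - 2 * \<epsilon>) / real q) \<le> real n powr ((1 - \<epsilon>) * ((1 - \<epsilon>) * c))"
    proof (rule powr_mono)
      have "(1 - 2 * \<epsilon>) * c \<le> ((1 - \<epsilon>) * (1 - \<epsilon>)) * c"
        using c by (intro mult_right_mono) (auto simp: algebra_simps)
      then show "(1 - 2 * \<epsilon>) / real q \<le> (1 - \<epsilon>) * ((1 - \<epsilon>) * c)" by (simp add: c_def)
    qed (use elim in auto)
    with pn have "real n powr ((1 - 2 * \<epsilon>) / real q) \<le> real p" by linarith
    moreover have "p > 2" using pn elim by simp
    moreover have "2 * real p ^ q \<le> \<epsilon> * real n"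
    proof -
      have "real p \<le> 2 * x n" using p(3) mx by linarith
      then have "real p \<le> (\<epsilon> * real n / 2) powr c" by (simp add: x_def)
      then have "real p ^ q \<le> ((\<epsilon> * real n / 2) powr c) ^ q" by (intro power_mono) auto
      also have "\<dots> = (\<epsilon> * real n / 2) powr (c * real q)"
        using eps elim by (simp add: powr_powr flip: powr_realpow)
      also have "\<dots> = \<epsilon> * real n / 2" using q eps elim by (simp add: c_def)
      finally show ?thesis by simp
    qed
    ultimately show ?case using p(1) by blast
  qed
qed

text \<open>In \<open>k \<ge> (1 - 4 * \<epsilon>) * n\<close>, one \<epsilon> each is lost to
  vertices outside the copies, the last layer, the matching and rounding. With
  \<open>n\<^sup>2 + 1 \<le> n ^ 3\<close> this gives the factor 12. Of the 8, seven come from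
  \<open>(1 - 3 * \<epsilon>) * (1 - 4 * \<epsilon>)\<close> and one from
  \<open>2 ^ n\<close>.\<close>

lemma H_cycle_upper_eps:
  assumes no_walk: "\<And>p a b. prime p \<Longrightarrow> p > 2 \<Longrightarrow> \<not> closed_walk p d f h a b" and h: "h \<ge> 2"
    and eps: "0 < \<epsilon>" "\<epsilon> \<le> 1 / 4"
  shows "\<forall>\<^sub>F n in at_top. real (H_cycle n (2 * h))
      \<le> real n powr ((1 - 1 / real (Suc d) + (12 * 3 ^ (2 * h) + 8) * \<epsilon>) * real n)"
proof -
  define c where "c = 1 / real (Suc d)"
  have c: "c > 0" "c \<le> 1" by (auto simp: c_def)
  define s where "s = nat \<lceil>1 / \<epsilon>\<rceil>"
  define L where "L = nat \<lceil>4 / \<epsilon>\<rceil>"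
  have s: "real s \<ge> 1 / \<epsilon>" unfolding s_def by linarith
  have L: "real L \<ge> 4 / \<epsilon>" unfolding L_def by linarith
  have "1 / \<epsilon> > 0" "4 / \<epsilon> > 0" using eps by auto
  then have s0: "real s > 0" and L0: "real L > 0" using s L by linarith+
  have c12: "(1 - 3 * \<epsilon>) * c < (1 - 2 * \<epsilon>) * c" "(1 - 2 * \<epsilon>) * c > 0" using c eps by auto
  have ev1: "\<forall>\<^sub>F n in at_top. \<exists>p. prime p \<and> p > 2 \<and> 2 * real p ^ Suc d \<le> \<epsilon> * real n
    \<and> real n powr ((1 - 2 * \<epsilon>) / real (Suc d)) \<le> real p"
    using eps by (intro eventually_prime_power_le) auto
  have ev2: "\<forall>\<^sub>F n in at_top. (real n powr ((1 - 2 * \<epsilon>) * c) / real s - 1) * \<epsilon> / (2 * real L) \<ge> real n powr ((1 - 3 * \<epsilon>) * c)"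
    using c12 s0 L0 eps by real_asymp
  have ev3: "\<forall>\<^sub>F n in at_top. real n powr ((1 - 2 * \<epsilon>) * c) / real s - 1 \<ge> 4 * (real L)\<^sup>2 / \<epsilon> + 1"
    using c12 s0 by real_asymp
  have ev4: "\<forall>\<^sub>F n in at_top. \<epsilon> * real n \<ge> 1" "\<forall>\<^sub>F n in at_top. real n powr \<epsilon> \<ge> 2"
    using eps by real_asymp+
  show ?thesis using ev1 ev2 ev3 ev4 eventually_ge_at_top[of 2]
  proof eventually_elim
    case (elim n)
    then obtain p where p: "prime p" "p > 2" "2 * real p ^ Suc d \<le> \<epsilon> * real n"
      "real n powr ((1 - 2 * \<epsilon>) * c) \<le> real p" by (auto simp: c_def)
    have n1: "real n \<ge> 2" using elim by simp
    define t where "t = p div s"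
    define \<tau> where "\<tau> = real t * \<epsilon> / (2 * real L)"
    have t_ge: "real t \<ge> real n powr ((1 - 2 * \<epsilon>) * c) / real s - 1"
    proof -
      have "real p / real s - 1 \<le> real t"
      proof -
        have "p < s * Suc t" unfolding t_def using dividend_less_times_div[of s p] s0 by simp
        then have "real p < real (s * Suc t)" by (simp only: of_nat_less_iff)
        then show ?thesis using s0 by (simp add: field_simps)
      qed
      moreover have "real n powr ((1 - 2 * \<epsilon>) * c) / real s \<le> real p / real s"
        using p(4) s0 by (intro divide_right_mono) auto
      ultimately show ?thesis by linarith
    qed
    have tL: "real t \<ge> 4 * (real L)\<^sup>2 / \<epsilon>" using t_ge elim by linarith
    have "4 * (real L)\<^sup>2 / \<epsilon> \<ge> 0" using eps by simp
    then have t0: "t > 0" using t_ge elim by linarith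
    have tau: "\<tau> \<ge> real n powr ((1 - 3 * \<epsilon>) * c)"
    proof -
      have "(real n powr ((1 - 2 * \<epsilon>) * c) / real s - 1) * \<epsilon> / (2 * real L) \<le> \<tau>"
        unfolding \<tau>_def using t_ge eps by (intro divide_right_mono mult_right_mono) auto
      then show ?thesis using elim by linarith
    qed
    \<comment> \<open>The size of one copy. It is at most \<open>\<epsilon> * n\<close>, so the
      fewer than \<open>W\<close> vertices left over by the copies are negligible.\<close>
    define W where "W = 2 * s * (t * p ^ d)"
    define r where "r = n div W"
    interpret V: voltage_graph p d s t r f
      using p(2) s0 t0 by unfold_locales (auto simp: t_def)
    have W0: "W > 0" unfolding W_def using s0 t0 p(2) by simp
    have We: "real W \<le> \<epsilon> * real n"
    proof -
      have "s * t \<le> p" by (simp add: t_def)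
      then have "W \<le> 2 * p ^ Suc d" unfolding W_def by (simp add: mult_right_mono flip: mult.assoc)
      then have "real W \<le> 2 * real p ^ Suc d" by (metis of_nat_le_iff of_nat_mult of_nat_numeral of_nat_power)
      then show ?thesis using p(3) by linarith
    qed
    have vn: "card V.verts = r * W" unfolding V.card_verts W_def ..
    then have vle: "card V.verts \<le> n" by (simp add: r_def)
    have vge: "real (card V.verts) \<ge> (1 - \<epsilon>) * real n"
    proof -
      have "n < r * W + W" unfolding r_def using W0 by (metis div_mult_mod_eq mod_less_divisor nat_add_left_cancel_less)
      then have "real n < real (r * W) + real W" by linarith
      then show ?thesis using We vn by (simp add: algebra_simps)
    qed
    have r0: "r > 0"
    proof -
      have "(1 - \<epsilon>) * real n > 0" using eps n1 by simp
      then show ?thesis using vge vn by (cases r) auto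
    qed
    have src: "real (card V.sources) \<ge> (1 - 2 * \<epsilon>) * real n"
    proof -
      have sc: "real (card V.sources) = real (card V.verts) * (1 - 1 / (2 * real s))"
        unfolding V.card_sources V.card_verts using s0 by (simp add: of_nat_diff field_simps)
      have "1 / real s \<le> \<epsilon>" using s s0 eps by (simp add: field_simps)
      then have "1 - \<epsilon> \<le> 1 - 1 / (2 * real s)" using eps by simp
      then have "(1 - \<epsilon>) * real n * (1 - \<epsilon>) \<le> real (card V.verts) * (1 - 1 / (2 * real s))"
        using vge eps by (intro mult_mono) auto
      moreover have "(1 - 2 * \<epsilon>) * real n \<le> (1 - \<epsilon>) * real n * (1 - \<epsilon>)"
        using n1 eps by (simp add: algebra_simps)
      ultimately show ?thesis using sc by linarith
    qed
    define k where "k = nat \<lfloor>(1 - \<epsilon>) * real (card V.sources)\<rfloor>"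
    have ks: "(1 - \<epsilon>) * real (card V.sources) \<ge> 0" using eps by simp
    then have k1: "real k \<le> (1 - \<epsilon>) * real (card V.sources)" and k2: "real k \<ge> (1 - \<epsilon>) * real (card V.sources) - 1"
      unfolding k_def by linarith+
    have k3: "real k \<ge> (1 - 4 * \<epsilon>) * real n"
    proof -
      have "(1 - \<epsilon>) * ((1 - 2 * \<epsilon>) * real n) \<le> (1 - \<epsilon>) * real (card V.sources)"
        using src eps by (intro mult_left_mono) auto
      moreover have "(1 - \<epsilon>) * ((1 - 2 * \<epsilon>) * real n) = (1 - 3 * \<epsilon>) * real n + 2 * (\<epsilon> * \<epsilon>) * real n"
        by (simp add: algebra_simps)
      moreover have "2 * (\<epsilon> * \<epsilon>) * real n \<ge> 0" by simp
      moreover have "(1 - 3 * \<epsilon>) * real n - 1 \<ge> (1 - 4 * \<epsilon>) * real n" using elim by (simp add: algebra_simps)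
      ultimately show ?thesis using k2 by linarith
    qed
    have "k \<le> n"
    proof -
      have "(1 - \<epsilon>) * real (card V.sources) \<le> 1 * real (card V.sources)"
        using eps by (intro mult_right_mono) auto
      moreover have "card V.sources \<le> card V.verts" using V.finite_verts by (intro card_mono) (auto simp: V.sources_def)
      ultimately show ?thesis using k1 vle by linarith
    qed
    then have nk: "real (n - k) \<le> 4 * \<epsilon> * real n" using k3 by (simp add: of_nat_diff algebra_simps)
    define R where "R = real n powr ((1 - c + (12 * 3 ^ (2 * h) + 8) * \<epsilon>) * real n)"
    have "real (H_cycle n (2 * h)) \<le> R"
    proof (rule H_cycle_le)
      fix F assume F: "F \<subseteq> ham_paths n" "creating (2 * h) F"
      have main: "real (card F) * \<tau> ^ k \<le> fact n * (real n ^ 2 + 1) ^ (3 ^ (2 * h) * (n - k)) * 2 ^ n"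
        unfolding \<tau>_def
        by (rule V.creating_bound[OF no_walk[OF p(1,2)] h vle r0 _ _ k1 L tL F]) (use eps in auto)
      have tau_pos: "\<tau> > 0" using tau n1 by (smt (verit) powr_gt_zero)
      have "real n powr ((1 - 3 * \<epsilon>) * c * ((1 - 4 * \<epsilon>) * real n)) \<le> real n powr ((1 - 3 * \<epsilon>) * c * real k)"
        using k3 n1 c eps by (intro powr_mono mult_left_mono) auto
      also have "\<dots> = (real n powr ((1 - 3 * \<epsilon>) * c)) ^ k"
        using n1 by (simp add: powr_powr flip: powr_realpow)
      also have "\<dots> \<le> \<tau> ^ k" using tau by (intro power_mono) auto
      finally have T: "real n powr ((1 - 3 * \<epsilon>) * c * ((1 - 4 * \<epsilon>) * real n)) \<le> \<tau> ^ k" .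
      have f1: "fact n \<le> real n powr real n"
        using fact_le_power[of n, where 'a = real] n1 by (simp add: powr_realpow)
      have f2: "(real n ^ 2 + 1) ^ (3 ^ (2 * h) * (n - k)) \<le> real n powr (3 * (3 ^ (2 * h) * (4 * \<epsilon> * real n)))"
      proof -
        have "real n ^ 2 + 1 \<le> real n ^ 3"
        proof -
          have "1 \<le> real n ^ 2" using n1 by simp
          then have "real n ^ 2 + 1 \<le> 2 * real n ^ 2" by simp
          also have "\<dots> \<le> real n * real n ^ 2" using n1 by (intro mult_right_mono) auto
          finally show ?thesis by (simp add: power3_eq_cube power2_eq_square)
        qed
        then have "(real n ^ 2 + 1) ^ (3 ^ (2 * h) * (n - k)) \<le> (real n ^ 3) ^ (3 ^ (2 * h) * (n - k))"
          by (intro power_mono) auto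
        also have "\<dots> = real n ^ (3 * (3 ^ (2 * h) * (n - k)))" by (rule power_mult[symmetric])
        also have "\<dots> = real n powr real (3 * (3 ^ (2 * h) * (n - k)))"
          using n1 by (intro powr_realpow[symmetric]) simp
        also have "real (3 * (3 ^ (2 * h) * (n - k))) = 3 * (3 ^ (2 * h) * real (n - k))" by simp
        also have "real n powr (3 * (3 ^ (2 * h) * real (n - k)))
            \<le> real n powr (3 * (3 ^ (2 * h) * (4 * \<epsilon> * real n)))"
          using nk n1 by (intro powr_mono mult_left_mono) auto
        finally show ?thesis .
      qed
      have f3: "2 ^ n \<le> real n powr (\<epsilon> * real n)"
      proof -
        have "2 ^ n \<le> (real n powr \<epsilon>) ^ n" using elim by (intro power_mono) auto
        also have "\<dots> = real n powr (\<epsilon> * real n)" using n1 by (simp add: powr_powr flip: powr_realpow)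
        finally show ?thesis .
      qed
      have "fact n * (real n ^ 2 + 1) ^ (3 ^ (2 * h) * (n - k)) * 2 ^ n
         \<le> real n powr real n * real n powr (3 * (3 ^ (2 * h) * (4 * \<epsilon> * real n))) * real n powr (\<epsilon> * real n)"
        using f1 f2 f3 by (intro mult_mono) auto
      also have "\<dots> = real n powr (real n + 3 * (3 ^ (2 * h) * (4 * \<epsilon> * real n)) + \<epsilon> * real n)"
        by (simp add: powr_add)
      also have "\<dots> \<le> real n powr ((1 - c + (12 * 3 ^ (2 * h) + 8) * \<epsilon>) * real n + (1 - 3 * \<epsilon>) * c * ((1 - 4 * \<epsilon>) * real n))"
      proof (rule powr_mono)
        have "(1 - 3 * \<epsilon>) * (1 - 4 * \<epsilon>) \<ge> 1 - 7 * \<epsilon>" using eps by (simp add: algebra_simps)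
        then have "c * ((1 - 3 * \<epsilon>) * (1 - 4 * \<epsilon>)) \<ge> c * (1 - 7 * \<epsilon>)" using c by (intro mult_left_mono) auto
        moreover have "c * \<epsilon> \<le> 1 * \<epsilon>" using c eps by (intro mult_right_mono) auto
        ultimately have "c * ((1 - 3 * \<epsilon>) * (1 - 4 * \<epsilon>)) \<ge> c - 7 * \<epsilon>" by (simp add: algebra_simps)
        then have "real n * (c * ((1 - 3 * \<epsilon>) * (1 - 4 * \<epsilon>))) \<ge> real n * (c - 7 * \<epsilon>)"
          by (intro mult_left_mono) auto
        then show "real n + 3 * (3 ^ (2 * h) * (4 * \<epsilon> * real n)) + \<epsilon> * real n
          \<le> (1 - c + (12 * 3 ^ (2 * h) + 8) * \<epsilon>) * real n + (1 - 3 * \<epsilon>) * c * ((1 - 4 * \<epsilon>) * real n)"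
          by (simp add: algebra_simps)
      qed (use n1 in auto)
      also have "\<dots> = R * real n powr ((1 - 3 * \<epsilon>) * c * ((1 - 4 * \<epsilon>) * real n))"
        unfolding R_def by (rule powr_add)
      also have "\<dots> \<le> R * \<tau> ^ k" using T by (intro mult_left_mono) (auto simp: R_def)
      finally have "real (card F) * \<tau> ^ k \<le> R * \<tau> ^ k" using main by linarith
      then show "real (card F) \<le> R" using tau_pos by simp
    qed
    then show ?case by (simp add: R_def c_def)
  qed
qed

text \<open>Each \<delta> has its own threshold, but no diagonal choice is necessary: the exact
  excess of the exponent, cut off at 0, is eventually below \<open>\<delta> * n\<close> for every
  \<delta>.\<close>

lemma little_o_exponent:
  fixes g :: "nat \<Rightarrow> nat"
  assumes "\<And>\<delta>. \<delta> > 0 \<Longrightarrow> \<forall>\<^sub>F n in at_top. real (g n) \<le> real n powr ((c + \<delta>) * real n)"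
  shows "\<exists>f. f \<in> o(\<lambda>n. real n) \<and> (\<forall>\<^sub>F n in at_top. real (g n) \<le> real n powr (c * real n + f n))"
proof (intro exI conjI)
  define f where "f n = (if g n = 0 then 0 else max 0 (log n (g n) - c * real n))" for n
  show "f \<in> o(\<lambda>n. real n)"
  proof (rule landau_o.smallI)
    fix \<delta> :: real assume \<delta>: "\<delta> > 0"
    show "\<forall>\<^sub>F n in at_top. norm (f n) \<le> \<delta> * norm (real n)"
      using assms[OF \<delta>] eventually_gt_at_top[of 1]
    proof eventually_elim
      case (elim n)
      show ?case
      proof (cases "g n = 0")
        case False
        then have "log n (g n) \<le> log n (real n powr ((c + \<delta>) * real n))"
          using elim by (subst log_le_cancel_iff) auto
        also have "\<dots> = (c + \<delta>) * real n" using elim by simp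
        finally show ?thesis using \<delta> False by (auto simp: f_def algebra_simps)
      qed (use \<delta> in \<open>simp add: f_def\<close>)
    qed
  qed
  show "\<forall>\<^sub>F n in at_top. real (g n) \<le> real n powr (c * real n + f n)"
    using eventually_gt_at_top[of 1]
  proof eventually_elim
    case (elim n)
    show ?case
    proof (cases "g n = 0")
      case False
      then have "real (g n) = real n powr (log n (g n))" using elim by simp
      also have "\<dots> \<le> real n powr (c * real n + f n)"
        using elim False by (intro powr_mono) (auto simp: f_def)
      finally show ?thesis .
    qed simp
  qed
qed

lemma H_cycle_upper:
  assumes no_walk: "\<And>p a b. prime p \<Longrightarrow> p > 2 \<Longrightarrow> \<not> closed_walk p d f h a b" and h: "h \<ge> 2"
  shows "\<exists>g. g \<in> o(\<lambda>n. real n) \<and>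
    (\<forall>\<^sub>F n in at_top. real (H_cycle n (2 * h)) \<le> real n powr ((1 - 1 / real (Suc d)) * real n + g n))"
proof (rule little_o_exponent)
  fix \<delta> :: real assume \<delta>: "\<delta> > 0"
  define C :: real where "C = 12 * 3 ^ (2 * h) + 8"
  have C: "C > 0" unfolding C_def by (intro add_pos_pos mult_pos_pos) auto
  define \<epsilon> where "\<epsilon> = min (1 / 4) (\<delta> / C)"
  have eps: "0 < \<epsilon>" "\<epsilon> \<le> 1 / 4" "C * \<epsilon> \<le> \<delta>"
    using \<delta> C by (auto simp: \<epsilon>_def min_def field_simps)
  have ev: "\<forall>\<^sub>F n in at_top. real (H_cycle n (2 * h)) \<le> real n powr ((1 - 1 / real (Suc d) + C * \<epsilon>) * real n)"
    unfolding C_def by (rule H_cycle_upper_eps[OF no_walk h eps(1,2)])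
  show "\<forall>\<^sub>F n in at_top. real (H_cycle n (2 * h)) \<le> real n powr ((1 - 1 / real (Suc d) + \<delta>) * real n)"
    using ev eventually_ge_at_top[of 1]
  proof eventually_elim
    case (elim n)
    have "real n powr ((1 - 1 / real (Suc d) + C * \<epsilon>) * real n) \<le> real n powr ((1 - 1 / real (Suc d) + \<delta>) * real n)"
      using elim eps(3) by (intro powr_mono mult_right_mono) auto
    then show ?case using elim by linarith
  qed
qed

theorem theorem2:
  shows "(\<exists>f. f \<in> o(\<lambda>n. real n) \<and>
            (\<forall>\<^sub>F n in at_top. real (H_cycle n 6) \<le> real n powr ((2/3) * real n + f n)))
       \<and> (\<exists>f. f \<in> o(\<lambda>n. real n) \<and>
            (\<forall>\<^sub>F n in at_top. real (H_cycle n 8) \<le> real n powr ((4/5) * real n + f n)))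
       \<and> (\<exists>f. f \<in> o(\<lambda>n. real n) \<and>
            (\<forall>\<^sub>F n in at_top. real (H_cycle n 10) \<le> real n powr ((4/5) * real n + f n)))"
proof (intro conjI)
  show "\<exists>f. f \<in> o(\<lambda>n. real n) \<and>
            (\<forall>\<^sub>F n in at_top. real (H_cycle n 6) \<le> real n powr ((2/3) * real n + f n))"
    using H_cycle_upper[of 2 "\<lambda>j x y. x * y ^ Suc j" 3] no_closed_walk_3 by simp
  show "\<exists>f. f \<in> o(\<lambda>n. real n) \<and>
            (\<forall>\<^sub>F n in at_top. real (H_cycle n 8) \<le> real n powr ((4/5) * real n + f n))"
    \<comment> \<open>Length 8 takes three monomials plus \<open>x\<^sup>2 * y\<close>, length 10
      takes four of the form \<open>x * y ^ j\<close>; both give \<open>d = 4\<close> and the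
      exponent \<open>1 - 1/5\<close>.\<close>
    using H_cycle_upper[of 4 mon8 4] no_closed_walk_4 by simp
  show "\<exists>f. f \<in> o(\<lambda>n. real n) \<and>
            (\<forall>\<^sub>F n in at_top. real (H_cycle n 10) \<le> real n powr ((4/5) * real n + f n))"
    using H_cycle_upper[of 4 "\<lambda>j x y. x * y ^ Suc j" 5] no_closed_walk_5 by simp
qed

end
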